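(* Let $\beta>0$. Let $m\to\infty$ and let $n=n_m$, $s=s_m$, $P=P_m$ depend on $m$. Assume that $s=O(1)$ and $\binom ms n^{-1}\to\beta$ as $m\to\infty$. Let $X_1$ have distribution $P$ and let $Z_{m1}=\binom{X_1}{s}\binom ms^{-1/2}n^{1/2}$. Suppose that there is a random variable $Z$ such that: (i) $Z_{m1}$ converges in distribution to $Z$; (ii) $\mathbf E Z<\infty$ and $\lim_{m\to\infty}\mathbf E Z_{m1}=\mathbf E Z$. Let $\alpha_s(m,P)$ be the clustering coefficient of the active random intersection graph $G_s(n,m,P)$. Then: (a) in the case where $0<\mathbf E Z^2<\infty$ and $\lim_{m\to\infty}\mathbf E Z_{m1}^2=\mathbf E Z^2$, we have, as $m\to\infty$, $$\alpha_s(m,P)=\frac1{\sqrt\beta}\,\frac{\mathbf E Z}{\mathbf E Z^2}+o(1);$$ (b) in the case where $\mathbf E Z^2=\infty$, we have $\alpha_s(m,P)=o(1)$ as $m\to\infty$.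
   Context: Active random intersection graph $G_s(n,m,P)$: let $W=\{w_1,\dots,w_m\}$, let $P$ be a probability distribution on $\{0,1,\dots,m\}$, and let $1\le s\le m$ be an integer. Let $D_1,\dots,D_n$ be independent identically distributed random subsets of $W$ with $\mathbf P(D_i=A)=P(|A|)\binom{m}{|A|}^{-1}$ for each $A\subset W$. The vertex set is $\{v_1,\dots,v_n\}$, and distinct vertices $v_i,v_j$ are adjacent ($v_i\sim v_j$) iff $|D_i\cap D_j|\ge s$. As usual $\binom{x}{s}=0$ for integers $0\le x<s$. Clustering coefficient: $\alpha_s(m,P)=\mathbf P(v_2\sim v_3\mid v_1\sim v_2,\ v_1\sim v_3)$; it does not depend on $n\ge3$ nor on the choice of the three distinct vertices. *)

theory Defs
  imports "HOL-Probability.Probability" "HOL-Probability.Product_PMF" "HOL-Library.Landau_Symbols"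
begin

text \<open>
  The attribute set \<open>W = {w\<^sub>1, \<dots>, w\<^sub>m}\<close> is represented by \<open>{1..m}\<close> and the vertex set
  \<open>{v\<^sub>1, \<dots>, v\<^sub>n}\<close> by \<open>{1..n}\<close>. A distribution on \<open>{0, \<dots>, m}\<close> is a \<open>nat pmf\<close> \<open>P\<close> with
  \<open>set_pmf P \<subseteq> {0..m}\<close>; for other \<open>P\<close> the following definition is not meaningful.
  Lemma \<open>pmf_random_subset\<close> identifies the law with the one given by
  \<open>P(|A|) / (m choose |A|)\<close>.
\<close>

definition random_subset :: "nat \<Rightarrow> nat pmf \<Rightarrow> nat set pmf" where
  "random_subset m P = bind_pmf P (\<lambda>k. pmf_of_set {A. A \<subseteq> {1..m} \<and> card A = k})"

lemma pmf_random_subset: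
  assumes P: "set_pmf P \<subseteq> {0..m}" and A: "A \<subseteq> {1..m}"
  shows "pmf (random_subset m P) A = pmf P (card A) / real (m choose card A)"
proof -
  let ?S = "\<lambda>k. {B. B \<subseteq> {1..m} \<and> card B = k}"
  have fin: "finite (?S k)" for k
    by (rule finite_subset[of _ "Pow {1..m}"]) auto
  have crd: "card (?S k) = m choose k" for k
    using n_subsets[of "{1..m}" k] by simp
  have ne: "?S k \<noteq> {}" if "k \<le> m" for k
    using crd[of k] that by (metis binomial_eq_0_iff card.empty not_less)
  have "pmf (random_subset m P) A = (\<integral>k. pmf (pmf_of_set (?S k)) A \<partial>measure_pmf P)"
    by (simp add: random_subset_def pmf_bind)
  also have "\<dots> = (\<integral>k. indicator {card A} k / real (m choose card A) \<partial>measure_pmf P)"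
  proof (rule integral_cong_AE)
    show "AE k in measure_pmf P. pmf (pmf_of_set (?S k)) A =
            indicator {card A} k / real (m choose card A)"
    proof (rule AE_pmfI)
      fix k assume "k \<in> set_pmf P"
      then have k: "k \<le> m" using P by auto
      show "pmf (pmf_of_set (?S k)) A = indicator {card A} k / real (m choose card A)"
        unfolding pmf_of_set[OF ne[OF k] fin] crd using A by (auto simp: indicator_def)
    qed
  qed simp_all
  also have "\<dots> = pmf P (card A) / real (m choose card A)"
    by (simp add: measure_pmf_single)
  finally show ?thesis .
qed

text \<open>The independent attribute sets \<open>D\<^sub>1, \<dots>, D\<^sub>n\<close> (with \<open>D i = {}\<close> for \<open>i\<close> not a vertex).\<close>

definition attribute_sets :: "nat \<Rightarrow> nat \<Rightarrow> nat pmf \<Rightarrow> (nat \<Rightarrow> nat set) pmf" where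
  "attribute_sets n m P = Pi_pmf {1..n} {} (\<lambda>_. random_subset m P)"

definition adjacent :: "nat \<Rightarrow> nat \<Rightarrow> (nat \<Rightarrow> nat set) \<Rightarrow> nat \<Rightarrow> nat \<Rightarrow> bool" where
  "adjacent n s D i j \<longleftrightarrow>
     i \<in> {1..n} \<and> j \<in> {1..n} \<and> i \<noteq> j \<and> s \<le> card (D i \<inter> D j)"

text \<open>
  Meaningful for \<open>n \<ge> 3\<close>. By the convention \<open>x / 0 = 0\<close> the value is \<open>0\<close> whenever the
  conditioning event has probability zero, in particular for \<open>n < 3\<close>.
\<close>

definition clustering_coeff :: "nat \<Rightarrow> nat \<Rightarrow> nat \<Rightarrow> nat pmf \<Rightarrow> real" where
  "clustering_coeff n s m P =
     \<P>(D in attribute_sets n m P. adjacent n s D 2 3 \<bar> adjacent n s D 1 2 \<and> adjacent n s D 1 3)"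

text \<open>
  \<open>Z\<^sub>m\<^sub>1\<close> as a function of the value \<open>x\<close> of \<open>X\<^sub>1\<close>; the random variable \<open>Z\<^sub>m\<^sub>1\<close> is this function
  on the probability space \<open>measure_pmf P\<close>.
\<close>

definition Zvar :: "nat \<Rightarrow> nat \<Rightarrow> nat \<Rightarrow> nat \<Rightarrow> real" where
  "Zvar n s m x = real (x choose s) * real (m choose s) powr (-1/2) * real n powr (1/2)"

end

theory Submission
  imports Defs
begin

text \<open>
  Write \<open>Y = X choose s\<close> and \<open>N = m choose s\<close>. Averaging over a random attribute set \<open>B\<close> turns
  \<open>|A \<inter> B| choose t\<close> into \<open>(|A| choose t) E(X choose t) / (m choose t)\<close>. Hence a vertex with attribute
  set \<open>A\<close> has a given neighbour with probability about \<open>(|A| choose s) E Y / N\<close>, and the path probability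
  is about \<open>(E Y)\<^sup>2 E Y\<^sup>2 / N\<^sup>2\<close>. A triangle whose three sets share fewer than \<open>s\<close> attributes forces
  \<open>s + 1\<close> coincidences between the third set and the union of the first two, which is negligible when
  the sets are small; so the triangle probability is about \<open>(E Y)\<^sup>3 / N\<^sup>2\<close> and the ratio is
  \<open>E Y / E Y\<^sup>2\<close>. Large sets are removed by uniform integrability of \<open>Y\<^sup>2\<close>, which follows from weak
  convergence together with convergence of the second moment.

  If \<open>E Y\<^sup>2 \<rightarrow> \<infinity>\<close>, the neighbour probability is still at least \<open>(|A| choose s) P(Y \<ge> 1) / N\<close> for
  every \<open>A\<close>. Triangles with a vertex satisfying \<open>Y \<le> K\<close> contribute \<open>O(K\<^sup>2 / N\<^sup>2)\<close>, and those with
  \<open>Y > K\<close> at all vertices at most \<open>E(Y; Y > K)\<^sup>2 E Y\<^sup>2 / N\<^sup>2\<close>; both are small relative to the path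
  probability.
\<close>

section \<open>Counting subsets\<close>

text \<open>From \<open>k = s\<close> upwards, Pascal's rule adds a positive term at each step, so
  \<open>k choose s\<close> is at least \<open>k - s + 1\<close>. Hence sets with few
  \<open>s\<close>-subsets have bounded size.\<close>

lemma choose_le_lower_index:
  assumes "1 \<le> s" "k choose s \<le> K"
  shows "k \<le> K + s"
proof (cases "s \<le> k")
  case True
  have "k - s + 1 \<le> k choose s"
    using True
  proof (induction k rule: dec_induct)
    case base then show ?case by simp
  next
    case (step j)
    obtain r where r: "s = Suc r" using assms by (cases s) auto
    have "0 < j choose r" using step r by (intro zero_less_binomial) simp
    then have "(j choose s) + 1 \<le> Suc j choose s" unfolding r binomial_Suc_Suc by linarith
    then show ?case using step by simp
  qed
  then show ?thesis using assms by linarith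
qed simp

text \<open>Follows from \<open>(s + 1) (k choose s + 1) = (k - s) (k choose s)\<close> and
  \<open>k - s \<le> K\<close>. It bounds the order \<open>s + 1\<close> binomials in the error
  terms by powers of \<open>K\<close>.\<close>

lemma choose_Suc_le_mult:
  assumes "1 \<le> s" "k choose s \<le> K"
  shows "k choose Suc s \<le> K * (k choose s)"
proof -
  have "(k choose Suc s) * 1 \<le> (k choose Suc s) * Suc s"
    by (rule mult_left_mono) auto
  also have "\<dots> = (k choose s) * (k - s)"
    using binomial_absorb_comp[of k s]
    by (metis Suc_times_binomial_eq binomial_absorption mult.commute)
  also have "\<dots> \<le> (k choose s) * K"
    using choose_le_lower_index[OF assms] by (intro mult_left_mono) auto
  finally show ?thesis by (simp add: mult.commute)
qed

text \<open>Removing \<open>S\<close> maps these sets bijectively to the subsets of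
  \<open>W - S\<close> of size \<open>k - |S|\<close>; trinomial revision does the rest. The product
  form avoids division of naturals, and both sides vanish when \<open>k < |S|\<close>.\<close>

lemma card_supersets_of_size:
  assumes W: "finite W" and S: "S \<subseteq> W" and k: "k \<le> card W"
  shows "card {B. S \<subseteq> B \<and> B \<subseteq> W \<and> card B = k} * (card W choose card S)
       = (card W choose k) * (k choose card S)"
proof (cases "card S \<le> k")
  case True
  have fS: "finite S" using W S finite_subset by blast
  have "bij_betw (\<lambda>B. B - S) {B. S \<subseteq> B \<and> B \<subseteq> W \<and> card B = k}
          {C. C \<subseteq> W - S \<and> card C = k - card S}"
  proof (rule bij_betw_byWitness[where f' = "\<lambda>C. C \<union> S"])
    show "(\<lambda>B. B - S) ` {B. S \<subseteq> B \<and> B \<subseteq> W \<and> card B = k} \<subseteq> {C. C \<subseteq> W - S \<and> card C = k - card S}"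
      using fS by (auto simp: card_Diff_subset)
    show "(\<lambda>C. C \<union> S) ` {C. C \<subseteq> W - S \<and> card C = k - card S} \<subseteq> {B. S \<subseteq> B \<and> B \<subseteq> W \<and> card B = k}"
    proof safe
      fix C assume C: "C \<subseteq> W - S" "card C = k - card S"
      have "finite C" using C W by (meson finite_Diff finite_subset)
      then have "card (C \<union> S) = card C + card S" using fS C by (intro card_Un_disjoint) auto
      then show "card (C \<union> S) = k" using C True by simp
    qed (use S in auto)
  qed auto
  then have "card {B. S \<subseteq> B \<and> B \<subseteq> W \<and> card B = k} = card (W - S) choose (k - card S)"
    using n_subsets[of "W - S" "k - card S"] W bij_betw_same_card by fastforce
  also have "card (W - S) = card W - card S" using fS S by (simp add: card_Diff_subset)
  finally show ?thesis using choose_mult[OF True k] by (simp add: mult.commute)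
next
  case False
  have "{B. S \<subseteq> B \<and> B \<subseteq> W \<and> card B = k} = {}"
    using False W by (auto dest: card_mono[rotated] finite_subset)
  then show ?thesis using False by (simp del: Collect_empty_eq)
qed

text \<open>\<open>|A \<inter> B| choose t\<close> counts the \<open>t\<close>-subsets of
  \<open>A\<close> that lie in \<open>B\<close>. Exchanging the sums leaves, for each fixed
  \<open>S\<close>, the total weight of the sets containing it.\<close>

lemma sum_over_subsets_choose:
  fixes f :: "'a set \<Rightarrow> real"
  assumes "finite W" "A \<subseteq> W"
  shows "(\<Sum>B\<in>Pow W. f B * real (card (A \<inter> B) choose t))
       = (\<Sum>S | S \<subseteq> A \<and> card S = t. \<Sum>B\<in>Pow W. f B * of_bool (S \<subseteq> B))"
proof -
  have fA: "finite A" using assms finite_subset by blast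
  have "real (card (A \<inter> B) choose t) = (\<Sum>S | S \<subseteq> A \<and> card S = t. of_bool (S \<subseteq> B))" for B
  proof -
    have "card (A \<inter> B) choose t = card {S. S \<subseteq> A \<inter> B \<and> card S = t}"
      using n_subsets[of "A \<inter> B" t] fA by simp
    also have "{S. S \<subseteq> A \<inter> B \<and> card S = t} = {S. S \<subseteq> A \<and> card S = t} \<inter> {S. S \<subseteq> B}" by auto
    finally show ?thesis using fA by (simp add: of_bool_def sum.If_cases)
  qed
  then have "(\<Sum>B\<in>Pow W. f B * real (card (A \<inter> B) choose t))
     = (\<Sum>B\<in>Pow W. \<Sum>S | S \<subseteq> A \<and> card S = t. f B * of_bool (S \<subseteq> B))"
    by (simp add: sum_distrib_left)
  then show ?thesis by (simp add: sum.swap[of _ "Pow W"])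
qed

definition subset_count :: "nat \<Rightarrow> nat \<Rightarrow> real" where
  "subset_count s k = real (k choose s)"

text \<open>The cut-off is placed on \<open>k choose s\<close>, the quantity whose moments are
  controlled, and is real-valued so that it multiplies into expectations.\<close>

definition low_count :: "nat \<Rightarrow> nat \<Rightarrow> nat \<Rightarrow> real" where
  "low_count s K k = of_bool (k choose s \<le> K)"

definition high_count :: "nat \<Rightarrow> nat \<Rightarrow> nat \<Rightarrow> real" where
  "high_count s K k = of_bool (K < k choose s)"

text \<open>The quotient \<open>(m choose s) / (m choose Suc s)\<close>, the price of one further
  coincidence; it tends to \<open>0\<close> for bounded \<open>s\<close>.\<close>

definition overlap_ratio :: "nat \<Rightarrow> nat \<Rightarrow> real" where
  "overlap_ratio m s = (real s + 1) / (real m - real s)"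

section \<open>Path and triangle probabilities\<close>

locale random_attribute_set =
  fixes m s :: nat and P :: "nat pmf"
  assumes s_pos: "1 \<le> s" and s_less: "s < m" and P: "set_pmf P \<subseteq> {0..m}"
begin

section \<open>Averages over one random attribute set\<close>

abbreviation ex :: "(nat \<Rightarrow> real) \<Rightarrow> real" where
  "ex f \<equiv> measure_pmf.expectation P f"

text \<open>The expectation over one attribute set, as a finite sum, so that linearity and exchange
  of averages need no integrability argument.\<close>

definition av :: "(nat set \<Rightarrow> real) \<Rightarrow> real" where
  "av f = (\<Sum>B\<in>Pow {1..m}. pmf (random_subset m P) B * f B)"

lemma ex_sum: "ex f = (\<Sum>k\<in>{0..m}. pmf P k * f k)"
  using P by (subst integral_measure_pmf_real[of "{0..m}"]) (auto simp: mult.commute)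

lemma ex_mono: "(\<And>k. k \<le> m \<Longrightarrow> f k \<le> g k) \<Longrightarrow> ex f \<le> ex g"
  unfolding ex_sum by (intro sum_mono mult_left_mono) auto

lemma ex_add: "ex (\<lambda>k. f k + g k) = ex f + ex g"
  unfolding ex_sum by (simp add: algebra_simps sum.distrib)

lemma ex_cmult: "ex (\<lambda>k. c * f k) = c * ex f"
  by simp

lemma av_mono: "(\<And>B. B \<subseteq> {1..m} \<Longrightarrow> f B \<le> g B) \<Longrightarrow> av f \<le> av g"
  unfolding av_def by (intro sum_mono mult_left_mono) auto

lemma av_cong: "(\<And>B. B \<subseteq> {1..m} \<Longrightarrow> f B = g B) \<Longrightarrow> av f = av g"
  unfolding av_def by (intro sum.cong) auto

lemma av_add: "av (\<lambda>B. f B + g B) = av f + av g"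
  unfolding av_def by (simp add: algebra_simps sum.distrib)

lemma av_diff: "av (\<lambda>B. f B - g B) = av f - av g"
  unfolding av_def by (simp add: algebra_simps sum_subtractf)

lemma av_cmult: "av (\<lambda>B. c * f B) = c * av f"
  unfolding av_def by (simp add: algebra_simps sum_distrib_left)

lemma av_cmult': "av (\<lambda>B. f B * c) = av f * c"
  unfolding av_def by (simp add: algebra_simps sum_distrib_left)

lemma av_nonneg: "(\<And>B. B \<subseteq> {1..m} \<Longrightarrow> 0 \<le> f B) \<Longrightarrow> 0 \<le> av f"
  unfolding av_def by (intro sum_nonneg mult_nonneg_nonneg) auto

lemma av_swap: "av (\<lambda>A. av (\<lambda>B. f A B)) = av (\<lambda>B. av (\<lambda>A. f A B))"
  unfolding av_def sum_distrib_left
  by (subst sum.swap) (simp add: algebra_simps)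

text \<open>Given \<open>|B| = k\<close> the set is uniform, so by
  \<open>card_supersets_of_size\<close> it contains \<open>S\<close> with probability
  \<open>(k choose |S|) / (m choose |S|)\<close>.\<close>

lemma av_superset:
  assumes S: "S \<subseteq> {1..m}"
  shows "av (\<lambda>B. g (card B) * of_bool (S \<subseteq> B))
       = ex (\<lambda>k. g k * real (k choose card S)) / real (m choose card S)"
proof -
  let ?t = "card S"
  have t: "?t \<le> m" using card_mono[OF _ S] by simp
  have "av (\<lambda>B. g (card B) * of_bool (S \<subseteq> B))
      = (\<Sum>B\<in>Pow {1..m}. pmf P (card B) / real (m choose card B) * g (card B) * of_bool (S \<subseteq> B))"
    unfolding av_def by (intro sum.cong) (auto simp: pmf_random_subset[OF P])
  also have "\<dots> = (\<Sum>k\<in>{0..m}. \<Sum>B | B \<in> Pow {1..m} \<and> card B = k.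
        pmf P (card B) / real (m choose card B) * g (card B) * of_bool (S \<subseteq> B))"
    by (rule sum.group[symmetric]) (auto dest!: card_mono[rotated])
  also have "\<dots> = (\<Sum>k\<in>{0..m}. pmf P k * (g k * real (k choose ?t)) / real (m choose ?t))"
  proof (rule sum.cong)
    fix k assume k: "k \<in> {0..m}"
    have "(\<Sum>B | B \<in> Pow {1..m} \<and> card B = k.
        pmf P (card B) / real (m choose card B) * g (card B) * of_bool (S \<subseteq> B))
      = (\<Sum>B | B \<in> Pow {1..m} \<and> card B = k. pmf P k / real (m choose k) * g k * of_bool (S \<subseteq> B))"
      by (intro sum.cong) auto
    also have "\<dots> = pmf P k / real (m choose k) * g k * (\<Sum>B | B \<in> Pow {1..m} \<and> card B = k. of_bool (S \<subseteq> B))"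
      by (simp only: sum_distrib_left)
    also have "(\<Sum>B | B \<in> Pow {1..m} \<and> card B = k. of_bool (S \<subseteq> B)) =
       real (card ({B. B \<in> Pow {1..m} \<and> card B = k} \<inter> {B. S \<subseteq> B}))"
      by (subst sum_of_bool_eq) auto
    also have "{B. B \<in> Pow {1..m} \<and> card B = k} \<inter> {B. S \<subseteq> B} = {B. S \<subseteq> B \<and> B \<subseteq> {1..m} \<and> card B = k}"
      by auto
    also have "real (card {B. S \<subseteq> B \<and> B \<subseteq> {1..m} \<and> card B = k})
       = real (m choose k) * real (k choose ?t) / real (m choose ?t)"
      using card_supersets_of_size[of "{1..m}" S k] S k t
      by (simp add: field_simps flip: of_nat_mult)
    finally show "(\<Sum>B | B \<in> Pow {1..m} \<and> card B = k.
        pmf P (card B) / real (m choose card B) * g (card B) * of_bool (S \<subseteq> B))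
      = pmf P k * (g k * real (k choose ?t)) / real (m choose ?t)"
      using k by (simp add: field_simps)
  qed simp
  finally show ?thesis by (simp add: ex_sum sum_divide_distrib)
qed

text \<open>The exact first-moment identity behind all estimates: every \<open>t\<close>-subset of
  \<open>A\<close> lies in \<open>B\<close> with the same weighted probability, given by
  \<open>av_superset\<close>. Only the size of \<open>A\<close> enters, which allows iteration over
  several independent sets.\<close>

lemma av_choose:
  assumes A: "A \<subseteq> {1..m}"
  shows "av (\<lambda>B. g (card B) * real (card (A \<inter> B) choose t))
       = real (card A choose t) * (ex (\<lambda>k. g k * real (k choose t)) / real (m choose t))"
proof -
  have fA: "finite A" using A finite_subset by blast
  have "av (\<lambda>B. g (card B) * real (card (A \<inter> B) choose t))
      = (\<Sum>S | S \<subseteq> A \<and> card S = t. av (\<lambda>B. g (card B) * of_bool (S \<subseteq> B)))"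
    using sum_over_subsets_choose[of "{1..m}" A "\<lambda>B. pmf (random_subset m P) B * g (card B)" t] A
    by (simp add: av_def mult.assoc)
  also have "\<dots> = (\<Sum>S | S \<subseteq> A \<and> card S = t. ex (\<lambda>k. g k * real (k choose t)) / real (m choose t))"
    using A by (intro sum.cong refl) (subst av_superset, auto)
  also have "\<dots> = real (card A choose t) * (ex (\<lambda>k. g k * real (k choose t)) / real (m choose t))"
    using n_subsets[OF fA, of t] by simp
  finally show ?thesis .
qed

lemma av_card: "av (\<lambda>B. g (card B)) = ex g"
  using av_choose[of "{}" g 0] by simp

section \<open>Edge indicators and the probability of a given neighbour\<close>

abbreviation "Y \<equiv> subset_count s"

abbreviation "low \<equiv> low_count s"

abbreviation "high \<equiv> high_count s"

abbreviation "\<delta> \<equiv> overlap_ratio m s"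

definition meets :: "nat set \<Rightarrow> nat set \<Rightarrow> real" where
  "meets A B = of_bool (s \<le> card (A \<inter> B))"

definition N :: real where "N = real (m choose s)"

text \<open>Given the set of the middle vertex, its two edges are independent and equally likely;
  hence the square.\<close>

definition path_prob :: real where
  "path_prob = av (\<lambda>A. (av (meets A))\<^sup>2)"

definition triangle_prob :: real where
  "triangle_prob = av (\<lambda>A. av (\<lambda>B. av (\<lambda>C. meets A B * meets A C * meets B C)))"

lemma N_pos: "0 < N"
  using s_less by (simp add: N_def)

lemma subset_count_nonneg: "0 \<le> Y k"
  by (simp add: subset_count_def)

lemma overlap_ratio_nonneg: "0 \<le> \<delta>"
  using s_less by (simp add: overlap_ratio_def)

lemma choose_Suc_eq: "real (m choose Suc s) = N / \<delta>"
proof -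
  have "Suc s * (m choose Suc s) = (m - s) * (m choose s)"
    by (metis Suc_times_binomial_eq binomial_absorb_comp binomial_absorption)
  then have "real (Suc s) * real (m choose Suc s) = real (m - s) * real (m choose s)"
    by (metis of_nat_mult)
  then have "(real s + 1) * real (m choose Suc s) = (real m - real s) * N"
    using s_less by (simp add: N_def of_nat_diff add.commute)
  then show ?thesis
    using s_less by (simp add: overlap_ratio_def field_simps)
qed

lemma meets_commute: "meets A B = meets B A"
  by (simp add: meets_def Int_commute)

lemma meets_nonneg: "0 \<le> meets A B"
  by (simp add: meets_def)

lemma low_count_nonneg: "0 \<le> low K k" and high_count_nonneg: "0 \<le> high K k"
  by (simp_all add: low_count_def high_count_def)

lemma low_add_high: "low K k + high K k = 1"
  by (simp add: low_count_def high_count_def of_bool_def)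

lemma one_le_choose: "r \<le> k \<Longrightarrow> 1 \<le> k choose r" for r k :: nat
  using zero_less_binomial[of r k] by linarith

lemma meets_le_choose: "meets A B \<le> real (card (A \<inter> B) choose s)"
  using one_le_choose[of s "card (A \<inter> B)"] by (simp add: meets_def of_bool_def)

text \<open>First-moment bound: the edge indicator is at most the number of \<open>s\<close>-subsets
  common to both sets. The weight \<open>g\<close> serves to restrict the neighbour to large
  sets.\<close>

lemma av_meets_le:
  assumes A: "A \<subseteq> {1..m}" and g: "\<And>k. 0 \<le> g k"
  shows "av (\<lambda>B. g (card B) * meets A B) \<le> Y (card A) * (ex (\<lambda>k. g k * Y k) / N)"
proof -
  have "av (\<lambda>B. g (card B) * meets A B) \<le> av (\<lambda>B. g (card B) * real (card (A \<inter> B) choose s))"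
    by (intro av_mono mult_left_mono meets_le_choose g)
  then show ?thesis by (simp add: av_choose[OF A] subset_count_def N_def)
qed

text \<open>The fraction of the \<open>s\<close>-subsets of \<open>B\<close> that lie in
  \<open>A\<close> is at most the edge indicator, and averaging it cancels the factor
  \<open>Y\<close> of \<open>B\<close>. No bound on the size of \<open>A\<close> enters.\<close>

lemma av_meets_ge_nonempty:
  assumes A: "A \<subseteq> {1..m}"
  shows "Y (card A) * (ex (high 0) / N) \<le> av (meets A)"
proof -
  have "Y (card A) * (ex (high 0) / N) = Y (card A) * (ex (\<lambda>k. 1 / Y k * Y k) / N)"
  proof -
    \<comment> \<open>With \<open>1 / 0 = 0\<close> the product is \<open>0\<close> exactly where
      \<open>Y k = 0\<close>, matching the indicator of \<open>Y > 0\<close>.\<close>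
    have "high 0 = (\<lambda>k. 1 / Y k * Y k)" by (auto simp: fun_eq_iff high_count_def subset_count_def)
    then show ?thesis by simp
  qed
  also have "\<dots> = av (\<lambda>B. 1 / Y (card B) * real (card (A \<inter> B) choose s))"
    using av_choose[OF A, of "\<lambda>k. 1 / Y k" s] by (simp add: subset_count_def N_def)
  also have "\<dots> \<le> av (meets A)"
  proof (rule av_mono)
    fix B :: "nat set" assume "B \<subseteq> {1..m}"
    then have "finite B" by (simp add: finite_subset)
    then have "card (A \<inter> B) choose s \<le> card B choose s"
      by (intro binomial_right_mono card_mono) auto
    then show "1 / Y (card B) * real (card (A \<inter> B) choose s) \<le> meets A B"
      by (cases "s \<le> card (A \<inter> B)") (auto simp: meets_def subset_count_def divide_le_eq_1 binomial_eq_0)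
  qed
  finally show ?thesis .
qed

lemma ex_low_choose_Suc_le: "ex (\<lambda>k. low K k * real (k choose Suc s)) \<le> real K ^ 2"
proof -
  have "ex (\<lambda>k. low K k * real (k choose Suc s)) \<le> ex (\<lambda>k. real K ^ 2)"
  proof (rule ex_mono)
    fix k
    show "low K k * real (k choose Suc s) \<le> real K ^ 2"
    proof (cases "k choose s \<le> K")
      case True
      have "k choose Suc s \<le> K * K"
        using choose_Suc_le_mult[OF s_pos True] True by (meson mult_le_mono2 order_trans)
      then have "real (k choose Suc s) \<le> real (K * K)" by (rule of_nat_mono)
      then show ?thesis using True by (simp add: low_count_def power2_eq_square)
    qed (simp add: low_count_def)
  qed
  then show ?thesis by simp
qed

lemma ex_low_choose_Suc_nonneg: "0 \<le> ex (\<lambda>k. low K k * real (k choose Suc s))"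
  by (intro Bochner_Integration.integral_nonneg) (simp add: low_count_nonneg)

text \<open>Serves as a Bonferroni inequality without a sum over pairs of \<open>s\<close>-subsets.\<close>

lemma of_bool_ge_choose_diff:
  fixes j K :: nat
  assumes "j choose s \<le> K"
  shows "real (j choose s) - real K * real (j choose Suc s) \<le> of_bool (s \<le> j)"
proof (cases "Suc s \<le> j")
  case True
  \<comment> \<open>Beyond \<open>s\<close> the penalty is at least \<open>K\<close>, so the left
    side is at most \<open>0\<close>; at \<open>j = s\<close> it equals \<open>1\<close>, and below
    \<open>s\<close> both binomials vanish.\<close>
  then have "1 \<le> real (j choose Suc s)" using one_le_choose[of "Suc s" j] by simp
  then have "real K * 1 \<le> real K * real (j choose Suc s)" by (intro mult_left_mono) auto
  then show ?thesis using assms True by simp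
next
  case False
  then show ?thesis by (cases "j = s") (auto simp: binomial_eq_0)
qed

text \<open>\<open>of_bool_ge_choose_diff\<close> is averaged over low \<open>B\<close> by
  \<open>av_choose\<close>. The error \<open>K ^ 4\<close> collects one \<open>K\<close> from that
  inequality, one from \<open>choose_Suc_le_mult\<close> for \<open>A\<close>, and two from
  \<open>ex_low_choose_Suc_le\<close>.\<close>

lemma av_meets_ge_low:
  assumes A: "A \<subseteq> {1..m}" and K: "card A choose s \<le> K"
  shows "Y (card A) * ((ex (\<lambda>k. low K k * Y k) - real K ^ 4 * \<delta>) / N) \<le> av (meets A)"
proof -
  have "av (\<lambda>B. low K (card B) * real (card (A \<inter> B) choose s))
        - real K * av (\<lambda>B. low K (card B) * real (card (A \<inter> B) choose Suc s))
      = av (\<lambda>B. low K (card B) * (real (card (A \<inter> B) choose s) - real K * real (card (A \<inter> B) choose Suc s)))"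
    by (simp add: av_diff av_cmult right_diff_distrib mult.left_commute)
  also have "\<dots> \<le> av (meets A)"
  proof (rule av_mono)
    fix B :: "nat set"
    have "finite A" using A by (simp add: finite_subset)
    then have "card (A \<inter> B) choose s \<le> K"
      using K by (meson Int_lower1 binomial_right_mono card_mono order_trans)
    then show "low K (card B) * (real (card (A \<inter> B) choose s) - real K * real (card (A \<inter> B) choose Suc s)) \<le> meets A B"
      using of_bool_ge_choose_diff[of "card (A \<inter> B)" K]
      by (auto simp: meets_def low_count_def of_bool_def split: if_splits)
  qed
  finally have *: "Y (card A) * (ex (\<lambda>k. low K k * Y k) / N)
      - real K * (real (card A choose Suc s) * (ex (\<lambda>k. low K k * real (k choose Suc s)) / (N / \<delta>))) \<le> av (meets A)"
    by (simp add: av_choose[OF A] subset_count_def N_def choose_Suc_eq[unfolded N_def])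
  have "real (card A choose Suc s) \<le> real K * Y (card A)"
    using choose_Suc_le_mult[OF s_pos K] unfolding subset_count_def by (metis of_nat_le_iff of_nat_mult)
  then have "real (card A choose Suc s) * (ex (\<lambda>k. low K k * real (k choose Suc s)) / (N / \<delta>))
     \<le> (real K * Y (card A)) * (real K ^ 2 / (N / \<delta>))"
    using N_pos overlap_ratio_nonneg by (intro mult_mono divide_right_mono ex_low_choose_Suc_le)
      (auto intro!: divide_nonneg_nonneg mult_nonneg_nonneg ex_low_choose_Suc_nonneg simp: subset_count_nonneg)
  from mult_left_mono[OF this, of "real K"]
  have "real K * (real (card A choose Suc s) * (ex (\<lambda>k. low K k * real (k choose Suc s)) / (N / \<delta>)))
     \<le> Y (card A) * (real K ^ 4 * \<delta> / N)"
    by (simp add: power2_eq_square power4_eq_xxxx algebra_simps)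
  with * show ?thesis by (simp add: algebra_simps diff_divide_distrib)
qed

section \<open>Bounds on the path probability\<close>

lemma path_prob_upper: "path_prob \<le> ex (\<lambda>k. (Y k)\<^sup>2) * (ex Y / N)\<^sup>2"
proof -
  have "path_prob \<le> av (\<lambda>A. (Y (card A))\<^sup>2 * (ex Y / N)\<^sup>2)"
    unfolding path_prob_def
  proof (rule av_mono)
    fix A :: "nat set" assume A: "A \<subseteq> {1..m}"
    have "av (meets A) \<le> Y (card A) * (ex Y / N)"
      using av_meets_le[OF A, of "\<lambda>_. 1"] by simp
    from power_mono[OF this av_nonneg, of 2]
    show "(av (meets A))\<^sup>2 \<le> (Y (card A))\<^sup>2 * (ex Y / N)\<^sup>2"
      by (simp only: power_mult_distrib meets_nonneg)
  qed
  also have "\<dots> = ex (\<lambda>k. (Y k)\<^sup>2) * (ex Y / N)\<^sup>2"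
    by (simp add: av_cmult' av_card[of "\<lambda>k. (Y k)\<^sup>2"])
  finally show ?thesis .
qed

text \<open>The second moment enters untruncated, as the case of an infinite limit requires; the
  first moment is weakened to the probability that \<open>Y\<close> is positive.\<close>

lemma path_prob_lower_nonempty:
  "ex (\<lambda>k. (Y k)\<^sup>2) * (ex (high 0) / N)\<^sup>2 \<le> path_prob"
proof -
  have "ex (\<lambda>k. (Y k)\<^sup>2) * (ex (high 0) / N)\<^sup>2 = av (\<lambda>A. (Y (card A))\<^sup>2 * (ex (high 0) / N)\<^sup>2)"
    by (simp add: av_cmult' av_card[of "\<lambda>k. (Y k)\<^sup>2"])
  also have "\<dots> \<le> path_prob"
    unfolding path_prob_def
  proof (rule av_mono)
    fix A :: "nat set" assume A: "A \<subseteq> {1..m}"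
    have "0 \<le> ex (high 0)"
      by (intro Bochner_Integration.integral_nonneg) (simp add: high_count_nonneg)
    then have "0 \<le> Y (card A) * (ex (high 0) / N)" using N_pos subset_count_nonneg by simp
    from power_mono[OF av_meets_ge_nonempty[OF A] this, of 2]
    show "(Y (card A))\<^sup>2 * (ex (high 0) / N)\<^sup>2 \<le> (av (meets A))\<^sup>2"
      by (simp only: power_mult_distrib)
  qed
  finally show ?thesis .
qed

text \<open>Squares \<open>av_meets_ge_low\<close> at low middle vertices and drops the others. The
  sign hypothesis makes the squaring monotone.\<close>

lemma path_prob_lower_low:
  assumes "0 \<le> ex (\<lambda>k. low K k * Y k) - real K ^ 4 * \<delta>"
  shows "ex (\<lambda>k. low K k * (Y k)\<^sup>2) * ((ex (\<lambda>k. low K k * Y k) - real K ^ 4 * \<delta>) / N)\<^sup>2 \<le> path_prob"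
proof -
  let ?c = "(ex (\<lambda>k. low K k * Y k) - real K ^ 4 * \<delta>) / N"
  have "ex (\<lambda>k. low K k * (Y k)\<^sup>2) * ?c\<^sup>2 = av (\<lambda>A. (low K (card A) * (Y (card A))\<^sup>2) * ?c\<^sup>2)"
    by (simp only: av_cmult' av_card[of "\<lambda>k. low K k * (Y k)\<^sup>2"])
  also have "\<dots> \<le> path_prob"
    unfolding path_prob_def
  proof (rule av_mono)
    fix A :: "nat set" assume A: "A \<subseteq> {1..m}"
    show "(low K (card A) * (Y (card A))\<^sup>2) * ?c\<^sup>2 \<le> (av (meets A))\<^sup>2"
    proof (cases "card A choose s \<le> K")
      case True
      have "0 \<le> Y (card A) * ?c" using assms N_pos subset_count_nonneg by simp
      from power_mono[OF av_meets_ge_low[OF A True] this, of 2]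
      show ?thesis using True by (simp add: power_mult_distrib low_count_def del: times_divide_eq_right)
    qed (simp add: low_count_def)
  qed
  finally show ?thesis .
qed

section \<open>Bounds on the triangle probability\<close>

text \<open>For a fixed centre \<open>A\<close> the averages over the two ends factor, and
  \<open>av_meets_le\<close> bounds each.\<close>

lemma star_le:
  assumes g: "\<And>k. 0 \<le> g k" and h: "\<And>k. 0 \<le> h k"
  shows "av (\<lambda>A. av (\<lambda>B. av (\<lambda>C. g (card A) * ((h (card B) * meets A B) * (h (card C) * meets A C)))))
    \<le> ex (\<lambda>k. g k * (Y k)\<^sup>2) * (ex (\<lambda>k. h k * Y k) / N)\<^sup>2"
proof -
  have "av (\<lambda>A. av (\<lambda>B. av (\<lambda>C. g (card A) * ((h (card B) * meets A B) * (h (card C) * meets A C)))))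
     = av (\<lambda>A. g (card A) * (av (\<lambda>B. h (card B) * meets A B))\<^sup>2)"
    by (simp only: av_cmult av_cmult' power2_eq_square)
  also have "\<dots> \<le> av (\<lambda>A. (g (card A) * (Y (card A))\<^sup>2) * (ex (\<lambda>k. h k * Y k) / N)\<^sup>2)"
  proof (rule av_mono)
    fix A :: "nat set" assume A: "A \<subseteq> {1..m}"
    have "0 \<le> av (\<lambda>B. h (card B) * meets A B)"
      by (intro av_nonneg mult_nonneg_nonneg h meets_nonneg)
    from mult_left_mono[OF power_mono[OF av_meets_le[OF A h] this, of 2] g[of "card A"]]
    show "g (card A) * (av (\<lambda>B. h (card B) * meets A B))\<^sup>2
       \<le> (g (card A) * (Y (card A))\<^sup>2) * (ex (\<lambda>k. h k * Y k) / N)\<^sup>2"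
      by (simp only: power_mult_distrib mult.assoc)
  qed
  also have "\<dots> = ex (\<lambda>k. g k * (Y k)\<^sup>2) * (ex (\<lambda>k. h k * Y k) / N)\<^sup>2"
    by (simp only: av_cmult' av_card[of "\<lambda>k. g k * (Y k)\<^sup>2"])
  finally show ?thesis .
qed

text \<open>Exchanging the averages turns each summand into a star centred at its weighted vertex,
  so all three contribute equally.\<close>

lemma paths_le:
  assumes g: "\<And>k. 0 \<le> g k"
  shows "av (\<lambda>A. av (\<lambda>B. av (\<lambda>C. g (card A) * (meets A B * meets A C)
            + g (card B) * (meets A B * meets B C) + g (card C) * (meets A C * meets B C))))
    \<le> 3 * (ex (\<lambda>k. g k * (Y k)\<^sup>2) * (ex Y / N)\<^sup>2)"
proof -
  let ?S = "av (\<lambda>A. av (\<lambda>B. av (\<lambda>C. g (card A) * (meets A B * meets A C))))"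
  have "av (\<lambda>A. av (\<lambda>B. av (\<lambda>C. g (card B) * (meets A B * meets B C)))) = ?S"
    by (subst av_swap) (simp add: meets_commute)
  moreover have "av (\<lambda>A. av (\<lambda>B. av (\<lambda>C. g (card C) * (meets A C * meets B C)))) = ?S"
  proof -
    have "av (\<lambda>A. av (\<lambda>B. av (\<lambda>C. g (card C) * (meets A C * meets B C))))
        = av (\<lambda>A. av (\<lambda>C. av (\<lambda>B. g (card C) * (meets A C * meets B C))))"
      by (subst av_swap) (rule refl)
    also have "\<dots> = av (\<lambda>C. av (\<lambda>A. av (\<lambda>B. g (card C) * (meets A C * meets B C))))"
      by (rule av_swap)
    finally show ?thesis by (simp add: meets_commute)
  qed
  ultimately have "av (\<lambda>A. av (\<lambda>B. av (\<lambda>C. g (card A) * (meets A B * meets A C)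
            + g (card B) * (meets A B * meets B C) + g (card C) * (meets A C * meets B C)))) = 3 * ?S"
    by (simp add: av_add)
  then show ?thesis using star_le[OF g, of "\<lambda>_. 1"] by simp
qed

text \<open>Pointwise, a triangle either has a low vertex, and then contains the path centred there,
  or has only high vertices; in the latter case only the star from \<open>A\<close> to the high sets
  \<open>B\<close> and \<open>C\<close> is kept.\<close>

lemma triangle_prob_upper_nonempty:
  "triangle_prob \<le> 3 * (ex (\<lambda>k. low K k * (Y k)\<^sup>2) * (ex Y / N)\<^sup>2)
     + ex (\<lambda>k. (Y k)\<^sup>2) * (ex (\<lambda>k. high K k * Y k) / N)\<^sup>2"
proof -
  have "triangle_prob \<le> av (\<lambda>A. av (\<lambda>B. av (\<lambda>C. (low K (card A) * (meets A B * meets A C)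
            + low K (card B) * (meets A B * meets B C) + low K (card C) * (meets A C * meets B C))
            + 1 * ((high K (card B) * meets A B) * (high K (card C) * meets A C)))))"
    unfolding triangle_prob_def
    by (intro av_mono) (simp add: meets_def low_count_def high_count_def of_bool_def)
  also have "\<dots> \<le> 3 * (ex (\<lambda>k. low K k * (Y k)\<^sup>2) * (ex Y / N)\<^sup>2)
     + ex (\<lambda>k. 1 * (Y k)\<^sup>2) * (ex (\<lambda>k. high K k * Y k) / N)\<^sup>2"
    unfolding av_add[where g = "\<lambda>A. 1 * ((high K (card B) * meets A B) * (high K (card C) * meets A C))" for B C]
    using add_mono[OF paths_le[of "low K"] star_le[of "\<lambda>_. 1" "high K"]]
    by (simp add: low_count_nonneg high_count_nonneg av_add)
  finally show ?thesis by simp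
qed

text \<open>\<open>av_choose\<close> is applied to \<open>A \<inter> B\<close> and then to
  \<open>A\<close>; the last average involves \<open>|A|\<close> alone and contributes no
  denominator, hence the exponents \<open>3\<close> and \<open>2\<close>.\<close>

lemma av_common:
  assumes "t \<le> m"
  shows "av (\<lambda>A. av (\<lambda>B. av (\<lambda>C. g (card A) * g (card B) * g (card C) * real (card (A \<inter> B \<inter> C) choose t))))
     = ex (\<lambda>k. g k * real (k choose t)) ^ 3 / real (m choose t) ^ 2"
proof -
  let ?e = "ex (\<lambda>k. g k * real (k choose t)) / real (m choose t)"
  have "av (\<lambda>A. av (\<lambda>B. av (\<lambda>C. g (card A) * g (card B) * g (card C) * real (card (A \<inter> B \<inter> C) choose t))))
     = av (\<lambda>A. av (\<lambda>B. g (card A) * (g (card B) * real (card (A \<inter> B) choose t)) * ?e))"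
  proof (intro av_cong)
    fix A B :: "nat set" assume "A \<subseteq> {1..m}" "B \<subseteq> {1..m}"
    then have "A \<inter> B \<subseteq> {1..m}" by auto
    from av_choose[OF this, of g t]
    show "av (\<lambda>C. g (card A) * g (card B) * g (card C) * real (card (A \<inter> B \<inter> C) choose t))
       = g (card A) * (g (card B) * real (card (A \<inter> B) choose t)) * ?e"
      by (simp only: av_cmult mult.assoc)
  qed
  also have "\<dots> = av (\<lambda>A. g (card A) * (real (card A choose t) * ?e)) * ?e"
    unfolding av_cmult' av_cmult by (intro arg_cong2[where f = "(*)"] av_cong refl) (simp only: av_choose)
  also have "\<dots> = av (\<lambda>A. g (card A) * real (card A choose t)) * ?e * ?e"
    unfolding mult.assoc[symmetric] av_cmult' by simp
  also have "\<dots> = ex (\<lambda>k. g k * real (k choose t)) * ?e * ?e"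
    by (simp only: av_card[of "\<lambda>k. g k * real (k choose t)"])
  finally show ?thesis by (simp add: power3_eq_cube power2_eq_square)
qed

text \<open>Three sets sharing \<open>s\<close> attributes form a triangle, and
  \<open>of_bool_ge_choose_diff\<close> is applied to the size of their intersection. The error has
  \<open>K * (K ^ 2) ^ 3 = K ^ 7\<close>, and \<open>\<delta>\<close> is squared because
  \<open>m choose Suc s\<close> enters squared.\<close>

lemma triangle_prob_lower:
  "(ex (\<lambda>k. low K k * Y k) ^ 3 - real K ^ 7 * \<delta>\<^sup>2) / N\<^sup>2 \<le> triangle_prob"
proof -
  let ?l = "\<lambda>A B C. low K (card A) * low K (card B) * low K (card C)"
  have "av (\<lambda>A. av (\<lambda>B. av (\<lambda>C. ?l A B C * real (card (A \<inter> B \<inter> C) choose s))))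
      - real K * av (\<lambda>A. av (\<lambda>B. av (\<lambda>C. ?l A B C * real (card (A \<inter> B \<inter> C) choose Suc s))))
      = av (\<lambda>A. av (\<lambda>B. av (\<lambda>C. ?l A B C * real (card (A \<inter> B \<inter> C) choose s)
        - real K * (?l A B C * real (card (A \<inter> B \<inter> C) choose Suc s)))))"
    by (simp only: av_diff av_cmult)
  also have "\<dots> \<le> triangle_prob"
    unfolding triangle_prob_def
  proof (intro av_mono)
    fix A B C :: "nat set" assume sub: "A \<subseteq> {1..m}" "B \<subseteq> {1..m}" "C \<subseteq> {1..m}"
    then have fin: "finite A" "finite B" "finite C" by (auto simp: finite_subset)
    show "?l A B C * real (card (A \<inter> B \<inter> C) choose s)
        - real K * (?l A B C * real (card (A \<inter> B \<inter> C) choose Suc s))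
       \<le> meets A B * meets A C * meets B C"
    proof (cases "card A choose s \<le> K \<and> card B choose s \<le> K \<and> card C choose s \<le> K")
      case True
      have "card (A \<inter> B \<inter> C) \<le> card A" using fin by (intro card_mono) auto
      then have "card (A \<inter> B \<inter> C) choose s \<le> K"
        using True by (meson binomial_right_mono order_trans)
      moreover have "of_bool (s \<le> card (A \<inter> B \<inter> C)) \<le> meets A B * meets A C * meets B C"
      proof -
        have "card (A \<inter> B \<inter> C) \<le> card (A \<inter> B)" "card (A \<inter> B \<inter> C) \<le> card (A \<inter> C)"
             "card (A \<inter> B \<inter> C) \<le> card (B \<inter> C)"
          using fin by (auto intro!: card_mono)
        then show ?thesis by (simp add: meets_def)
      qed
      ultimately have "real (card (A \<inter> B \<inter> C) choose s) - real K * real (card (A \<inter> B \<inter> C) choose Suc s)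
          \<le> meets A B * meets A C * meets B C"
        using of_bool_ge_choose_diff order_trans by blast
      moreover have "?l A B C = 1" using True by (simp add: low_count_def)
      ultimately show ?thesis by simp
    next
      case False
      then have l: "?l A B C = 0" by (auto simp: low_count_def)
      show ?thesis unfolding l by (simp add: meets_nonneg)
    qed
  qed
  finally have *: "ex (\<lambda>k. low K k * Y k) ^ 3 / N\<^sup>2
      - real K * (ex (\<lambda>k. low K k * real (k choose Suc s)) ^ 3 / (N / \<delta>)\<^sup>2) \<le> triangle_prob"
    using s_less by (simp only: av_common less_imp_le Suc_leI subset_count_def choose_Suc_eq flip: N_def)
  have "ex (\<lambda>k. low K k * real (k choose Suc s)) ^ 3 \<le> (real K ^ 2) ^ 3"
    by (intro power_mono ex_low_choose_Suc_le ex_low_choose_Suc_nonneg)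
  then have "real K * (ex (\<lambda>k. low K k * real (k choose Suc s)) ^ 3 / (N / \<delta>)\<^sup>2)
      \<le> real K * ((real K ^ 2) ^ 3 / (N / \<delta>)\<^sup>2)"
    by (intro mult_left_mono divide_right_mono) auto
  also have "\<dots> = real K ^ 7 * \<delta>\<^sup>2 / N\<^sup>2"
    by (simp add: power_divide flip: power_mult power_Suc)
  finally show ?thesis using * by (simp add: diff_divide_distrib)
qed

text \<open>Inclusion-exclusion inside \<open>C\<close>: \<open>s + s\<close> minus at most
  \<open>s - 1\<close> leaves at least \<open>s + 1\<close>.\<close>

lemma card_Un_Int_ge_Suc:
  assumes fin: "finite A" "finite B" "finite C"
    and "s \<le> card (A \<inter> C)" "s \<le> card (B \<inter> C)" "card (A \<inter> B \<inter> C) < s"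
  shows "Suc s \<le> card ((A \<union> B) \<inter> C)"
proof -
  have "card (A \<inter> C) + card (B \<inter> C) = card ((A \<union> B) \<inter> C) + card (A \<inter> B \<inter> C)"
    using card_Un_Int[of "A \<inter> C" "B \<inter> C"] fin
    by (simp add: Int_Un_distrib2 Int_assoc Int_left_commute)
  then show ?thesis using assms(4-6) by linarith
qed

text \<open>Every triangle shares \<open>s\<close> attributes, or has a high vertex, or consists of
  low sets to which \<open>card_Un_Int_ge_Suc\<close> applies. The three summands bound these cases
  in this order.\<close>

lemma triangle_prob_upper:
  "triangle_prob \<le> ((ex Y) ^ 3 + 3 * (ex (\<lambda>k. high K k * (Y k)\<^sup>2) * (ex Y)\<^sup>2)
     + 4 ^ (K + s) * real K ^ 2 * \<delta> * (ex Y)\<^sup>2) / N\<^sup>2"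
proof -
  let ?paths = "\<lambda>A B C. high K (card A) * (meets A B * meets A C)
            + high K (card B) * (meets A B * meets B C) + high K (card C) * (meets A C * meets B C)"
  \<comment> \<open>Of the three edges only the one between \<open>A\<close> and \<open>B\<close> is
    kept; the other two are replaced by the \<open>s + 1\<close> coincidences of \<open>C\<close>
    with \<open>A \<union> B\<close>. Averaging then costs \<open>1 / N\<close> for the edge and
    \<open>\<delta> / N\<close> for the coincidences.\<close>
  let ?bad = "\<lambda>A B C. low K (card A) * low K (card B) * meets A B
            * (low K (card C) * real (card ((A \<union> B) \<inter> C) choose Suc s))"
  have "triangle_prob \<le> av (\<lambda>A. av (\<lambda>B. av (\<lambda>C. 1 * 1 * 1 * real (card (A \<inter> B \<inter> C) choose s)
       + ?paths A B C + ?bad A B C)))"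
    unfolding triangle_prob_def
  proof (intro av_mono)
    fix A B C :: "nat set" assume sub: "A \<subseteq> {1..m}" "B \<subseteq> {1..m}" "C \<subseteq> {1..m}"
    then have fin: "finite A" "finite B" "finite C" by (auto simp: finite_subset)
    have nn: "0 \<le> ?paths A B C" "0 \<le> ?bad A B C"
      by (simp_all add: meets_nonneg low_count_nonneg high_count_nonneg)
    show "meets A B * meets A C * meets B C
      \<le> 1 * 1 * 1 * real (card (A \<inter> B \<inter> C) choose s) + ?paths A B C + ?bad A B C"
    proof (cases "s \<le> card (A \<inter> B) \<and> s \<le> card (A \<inter> C) \<and> s \<le> card (B \<inter> C)")
      case False
      then have "meets A B * meets A C * meets B C = 0" by (auto simp: meets_def)
      then show ?thesis using nn by linarith
    next
      case True
      consider "s \<le> card (A \<inter> B \<inter> C)"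
        | "high K (card A) = 1 \<or> high K (card B) = 1 \<or> high K (card C) = 1"
        | "card (A \<inter> B \<inter> C) < s" "low K (card A) = 1" "low K (card B) = 1" "low K (card C) = 1"
        unfolding high_count_def low_count_def of_bool_eq_1_iff by linarith
      then show ?thesis
      proof cases
        case 1
        then have "1 \<le> real (card (A \<inter> B \<inter> C) choose s)"
          using one_le_choose[of s "card (A \<inter> B \<inter> C)"] by simp
        moreover have "meets A B * meets A C * meets B C \<le> 1" by (simp add: meets_def)
        ultimately show ?thesis using nn by linarith
      next
        case 2
        then have "1 \<le> ?paths A B C" using True by (auto simp: meets_def high_count_nonneg)
        moreover have "meets A B * meets A C * meets B C \<le> 1" by (simp add: meets_def)
        ultimately show ?thesis using nn by linarith
      next
        case 3
        then have "1 \<le> card ((A \<union> B) \<inter> C) choose Suc s"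
          using card_Un_Int_ge_Suc[OF fin] True by (intro one_le_choose) auto
        then have "1 \<le> ?bad A B C" using 3 True by (simp add: meets_def)
        moreover have "meets A B * meets A C * meets B C \<le> 1" by (simp add: meets_def)
        ultimately show ?thesis using nn by linarith
      qed
    qed
  qed
  also have "\<dots> = av (\<lambda>A. av (\<lambda>B. av (\<lambda>C. 1 * 1 * 1 * real (card (A \<inter> B \<inter> C) choose s))))
      + av (\<lambda>A. av (\<lambda>B. av (\<lambda>C. ?paths A B C))) + av (\<lambda>A. av (\<lambda>B. av (\<lambda>C. ?bad A B C)))"
    by (simp only: av_add)
  also have "av (\<lambda>A. av (\<lambda>B. av (\<lambda>C. 1 * 1 * 1 * real (card (A \<inter> B \<inter> C) choose s)))) = (ex Y) ^ 3 / N\<^sup>2"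
    using av_common[of s "\<lambda>_. 1"] s_less by (simp add: subset_count_def[abs_def] N_def)
  also have "av (\<lambda>A. av (\<lambda>B. av (\<lambda>C. ?paths A B C))) \<le> 3 * (ex (\<lambda>k. high K k * (Y k)\<^sup>2) * (ex Y / N)\<^sup>2)"
    by (rule paths_le) (rule high_count_nonneg)
  also have "av (\<lambda>A. av (\<lambda>B. av (\<lambda>C. ?bad A B C))) \<le> (ex Y)\<^sup>2 / N * (4 ^ (K + s) * (real K ^ 2 / (N / \<delta>)))"
  proof -
    have "av (\<lambda>A. av (\<lambda>B. av (\<lambda>C. ?bad A B C)))
       \<le> av (\<lambda>A. av (\<lambda>B. meets A B * (4 ^ (K + s) * (real K ^ 2 / (N / \<delta>)))))"
    proof (intro av_mono)
      fix A B :: "nat set" assume sub: "A \<subseteq> {1..m}" "B \<subseteq> {1..m}"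
      have eq: "av (\<lambda>C. ?bad A B C) = low K (card A) * low K (card B) * meets A B
          * (real (card (A \<union> B) choose Suc s) * (ex (\<lambda>k. low K k * real (k choose Suc s)) / (N / \<delta>)))"
        using sub by (simp only: av_cmult av_choose Un_least choose_Suc_eq)
      show "av (\<lambda>C. ?bad A B C) \<le> meets A B * (4 ^ (K + s) * (real K ^ 2 / (N / \<delta>)))"
      proof (cases "card A choose s \<le> K \<and> card B choose s \<le> K")
        case False
        then have l: "low K (card A) * low K (card B) = 0" by (auto simp: low_count_def)
        show ?thesis unfolding eq l using N_pos overlap_ratio_nonneg by (simp add: meets_nonneg av_def)
      next
        case True
        \<comment> \<open>Low sets have at most \<open>K + s\<close> elements, so every binomial of
          their union is at most \<open>4 ^ (K + s)\<close>. The crude constant suffices, since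
          \<open>\<delta>\<close> tends to \<open>0\<close> for fixed \<open>K\<close> and bounded
          \<open>s\<close>.\<close>
        then have "card A \<le> K + s" "card B \<le> K + s"
          using choose_le_lower_index[OF s_pos] by auto
        then have "card (A \<union> B) \<le> (K + s) + (K + s)" by (meson add_mono card_Un_le order_trans)
        then have "card (A \<union> B) \<le> 2 * (K + s)" by (simp only: mult_2)
        then have "(2::real) ^ card (A \<union> B) \<le> 2 ^ (2 * (K + s))" by (intro power_increasing) auto
        moreover have "real (card (A \<union> B) choose Suc s) \<le> 2 ^ card (A \<union> B)"
          using binomial_le_pow2[of "card (A \<union> B)" "Suc s"] of_nat_mono by fastforce
        ultimately have "real (card (A \<union> B) choose Suc s) \<le> 2 ^ (2 * (K + s))"
          by (rule order_trans[rotated])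
        also have "(2::real) ^ (2 * (K + s)) = 4 ^ (K + s)"
          unfolding power_mult by simp
        finally have "real (card (A \<union> B) choose Suc s) \<le> 4 ^ (K + s)" .
        then have "real (card (A \<union> B) choose Suc s) * (ex (\<lambda>k. low K k * real (k choose Suc s)) / (N / \<delta>))
           \<le> 4 ^ (K + s) * (real K ^ 2 / (N / \<delta>))"
          using N_pos overlap_ratio_nonneg by (intro mult_mono divide_right_mono ex_low_choose_Suc_le)
            (auto intro!: divide_nonneg_nonneg mult_nonneg_nonneg ex_low_choose_Suc_nonneg)
        moreover have "low K (card A) * low K (card B) * meets A B = meets A B" using True by (simp add: low_count_def)
        ultimately show ?thesis unfolding eq by (simp only:) (intro mult_left_mono meets_nonneg)
      qed
    qed
    also have "\<dots> = av (\<lambda>A. av (meets A)) * (4 ^ (K + s) * (real K ^ 2 / (N / \<delta>)))"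
      by (simp only: av_cmult')
    also have "\<dots> \<le> (ex Y)\<^sup>2 / N * (4 ^ (K + s) * (real K ^ 2 / (N / \<delta>)))"
    proof (rule mult_right_mono)
      have "av (\<lambda>A. av (meets A)) \<le> av (\<lambda>A. Y (card A) * (ex Y / N))"
        using av_meets_le[of _ "\<lambda>_. 1"] by (intro av_mono) simp
      also have "\<dots> = (ex Y)\<^sup>2 / N"
        unfolding av_cmult' av_card[of Y] by (simp add: power2_eq_square)
      finally show "av (\<lambda>A. av (meets A)) \<le> (ex Y)\<^sup>2 / N" .
    qed (use N_pos overlap_ratio_nonneg in simp)
    finally show ?thesis .
  qed
  finally show ?thesis
    by (simp add: add_divide_distrib power2_eq_square mult_ac)
qed

section \<open>From the random graph to averages\<close>

text \<open>Three coordinates of the product are split off and the remaining ones integrate out, so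
  the law of the triple does not involve \<open>n\<close>.\<close>

lemma attribute_sets_triple:
  assumes n: "3 \<le> n"
  shows "map_pmf (\<lambda>D. (D 1, D 2, D 3)) (attribute_sets n m P)
    = pair_pmf (random_subset m P) (pair_pmf (random_subset m P) (random_subset m P))"
proof -
  have eq: "{1..n} = insert 1 (insert 2 (insert 3 {4..n}))" using n by auto
  show ?thesis
    unfolding attribute_sets_def eq
    by (simp add: Pi_pmf_insert pair_map_pmf1 pair_map_pmf2 map_pmf_comp case_prod_unfold)
      (simp add: pair_pmf_def map_pmf_def bind_assoc_pmf bind_return_pmf)
qed

lemma set_random_subset: "set_pmf (random_subset m P) \<subseteq> Pow {1..m}"
proof -
  have "finite {A. A \<subseteq> {1..m} \<and> card A = k}" for k by simp
  moreover have "{A. A \<subseteq> {1..m} \<and> card A = k} \<noteq> {}" if "k \<le> m" for k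
    using that n_subsets[of "{1..m}" k] by (metis binomial_eq_0_iff card.empty card_atLeastAtMost diff_Suc_1 finite_atLeastAtMost not_less)
  ultimately show ?thesis
    using P unfolding random_subset_def by (fastforce simp: set_pmf_of_set)
qed

lemma prob_triple:
  assumes n: "3 \<le> n"
  shows "measure_pmf.prob (attribute_sets n m P) {D. Q (D 1) (D 2) (D 3)}
    = av (\<lambda>A. av (\<lambda>B. av (\<lambda>C. of_bool (Q A B C))))"
proof -
  let ?R = "random_subset m P" and ?W = "Pow {1..m}"
  let ?T = "pair_pmf ?R (pair_pmf ?R ?R)"
  have "measure_pmf.prob (attribute_sets n m P) {D. Q (D 1) (D 2) (D 3)}
    = measure_pmf.prob (map_pmf (\<lambda>D. (D 1, D 2, D 3)) (attribute_sets n m P)) {(A, B, C). Q A B C}"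
    by (simp add: vimage_def)
  also have "\<dots> = measure_pmf.prob ?T {(A, B, C). Q A B C}"
    by (simp only: attribute_sets_triple[OF n])
  also have "\<dots> = measure_pmf.expectation ?T (\<lambda>(A, B, C). of_bool (Q A B C))"
  proof -
    have "(\<lambda>(A, B, C). of_bool (Q A B C)) = (indicator {(A, B, C). Q A B C} :: _ \<Rightarrow> real)"
      by (auto simp: fun_eq_iff indicator_def)
    then show ?thesis by simp
  qed
  also have "\<dots> = (\<Sum>(A, B, C)\<in>?W \<times> ?W \<times> ?W. of_bool (Q A B C) * (pmf ?R A * (pmf ?R B * pmf ?R C)))"
    using set_random_subset
    by (subst integral_measure_pmf_real[of "?W \<times> ?W \<times> ?W"]) (auto simp: pmf_pair intro!: sum.cong)
  also have "\<dots> = av (\<lambda>A. av (\<lambda>B. av (\<lambda>C. of_bool (Q A B C))))"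
    unfolding av_def by (simp add: sum_distrib_left mult_ac del: sum_mult_of_bool_eq sum_of_bool_mult_eq flip: sum.cartesian_product)
  finally show ?thesis .
qed

text \<open>By \<open>x / 0 = 0\<close> on both sides the identity also covers a vanishing path
  probability.\<close>

lemma clustering_coeff_eq:
  assumes n: "3 \<le> n"
  shows "clustering_coeff n s m P = triangle_prob / path_prob"
proof -
  have "measure_pmf.prob (attribute_sets n m P) {D. adjacent n s D 1 2 \<and> adjacent n s D 1 3} = path_prob"
    using prob_triple[OF n, of "\<lambda>A B C. s \<le> card (A \<inter> B) \<and> s \<le> card (A \<inter> C)"] n
    by (simp add: adjacent_def path_prob_def power2_eq_square of_bool_conj av_cmult av_cmult' flip: meets_def)
  moreover have "measure_pmf.prob (attribute_sets n m P)
      {D. adjacent n s D 2 3 \<and> adjacent n s D 1 2 \<and> adjacent n s D 1 3} = triangle_prob"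
    using prob_triple[OF n, of "\<lambda>A B C. s \<le> card (B \<inter> C) \<and> s \<le> card (A \<inter> B) \<and> s \<le> card (A \<inter> C)"] n
    by (simp add: adjacent_def triangle_prob_def of_bool_conj mult_ac flip: meets_def)
  ultimately show ?thesis
    unfolding clustering_coeff_def cond_prob_def by simp
qed

section \<open>Bounds on the clustering coefficient\<close>

lemma triangle_prob_nonneg: "0 \<le> triangle_prob"
  by (simp add: triangle_prob_def av_nonneg meets_nonneg)

text \<open>The lower bound on triangles is divided by the upper bound on paths, and the powers of
  \<open>N\<close> cancel. The hypotheses on the truncated moments make the path probability
  positive.\<close>

lemma clustering_coeff_lower:
  assumes n: "3 \<le> n" and E1: "0 < ex Y" and E2: "0 < ex (\<lambda>k. low K k * (Y k)\<^sup>2)"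
    and F1: "0 < ex (\<lambda>k. low K k * Y k) - real K ^ 4 * \<delta>"
  shows "(ex (\<lambda>k. low K k * Y k) ^ 3 - real K ^ 7 * \<delta>\<^sup>2) / (ex (\<lambda>k. (Y k)\<^sup>2) * (ex Y)\<^sup>2)
    \<le> clustering_coeff n s m P"
proof -
  let ?L = "ex (\<lambda>k. low K k * Y k) ^ 3 - real K ^ 7 * \<delta>\<^sup>2"
  have "0 < ex (\<lambda>k. low K k * (Y k)\<^sup>2) * ((ex (\<lambda>k. low K k * Y k) - real K ^ 4 * \<delta>) / N)\<^sup>2"
    using E2 F1 N_pos by (intro mult_pos_pos zero_less_power divide_pos_pos)
  also have "\<dots> \<le> path_prob"
    using F1 by (intro path_prob_lower_low) simp
  finally have p: "0 < path_prob" .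
  have "?L * path_prob \<le> triangle_prob * (ex (\<lambda>k. (Y k)\<^sup>2) * (ex Y)\<^sup>2)"
  \<comment> \<open>A negative \<open>?L\<close> reverses the comparison with the upper bound on
    paths, but then the claim is trivial because the triangle side is nonnegative.\<close>
  proof (cases "0 \<le> ?L")
    case True
    have "?L * path_prob \<le> ?L * (ex (\<lambda>k. (Y k)\<^sup>2) * (ex Y / N)\<^sup>2)"
      by (intro mult_left_mono path_prob_upper True)
    also have "\<dots> = ?L / N\<^sup>2 * (ex (\<lambda>k. (Y k)\<^sup>2) * (ex Y)\<^sup>2)"
      by (simp add: power_divide)
    also have "\<dots> \<le> triangle_prob * (ex (\<lambda>k. (Y k)\<^sup>2) * (ex Y)\<^sup>2)"
      by (intro mult_right_mono triangle_prob_lower) simp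
    finally show ?thesis .
  next
    case False
    then have "?L * path_prob \<le> 0" using p by (simp add: mult_le_0_iff)
    also have "0 \<le> triangle_prob * (ex (\<lambda>k. (Y k)\<^sup>2) * (ex Y)\<^sup>2)"
      by (simp add: triangle_prob_nonneg)
    finally show ?thesis .
  qed
  moreover have "0 < ex (\<lambda>k. (Y k)\<^sup>2) * (ex Y)\<^sup>2"
  proof -
    have "ex (\<lambda>k. low K k * (Y k)\<^sup>2) \<le> ex (\<lambda>k. (Y k)\<^sup>2)"
      by (intro ex_mono) (simp add: low_count_def)
    then show ?thesis using E1 E2 by simp
  qed
  ultimately show ?thesis using p by (simp add: clustering_coeff_eq[OF n] field_simps)
qed

lemma clustering_coeff_upper:
  assumes n: "3 \<le> n" and E2: "0 < ex (\<lambda>k. low K k * (Y k)\<^sup>2)"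
    and F1: "0 < ex (\<lambda>k. low K k * Y k) - real K ^ 4 * \<delta>"
  shows "clustering_coeff n s m P \<le>
    ((ex Y) ^ 3 + 3 * (ex (\<lambda>k. high K k * (Y k)\<^sup>2) * (ex Y)\<^sup>2)
     + 4 ^ (K + s) * real K ^ 2 * \<delta> * (ex Y)\<^sup>2)
    / (ex (\<lambda>k. low K k * (Y k)\<^sup>2) * (ex (\<lambda>k. low K k * Y k) - real K ^ 4 * \<delta>)\<^sup>2)"
proof -
  let ?p = "ex (\<lambda>k. low K k * (Y k)\<^sup>2) * ((ex (\<lambda>k. low K k * Y k) - real K ^ 4 * \<delta>) / N)\<^sup>2"
  have p: "0 < ?p"
    using E2 F1 N_pos by (intro mult_pos_pos zero_less_power divide_pos_pos)
  have "triangle_prob / path_prob \<le> triangle_prob / ?p"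
  proof (rule divide_left_mono)
    show "?p \<le> path_prob" using F1 by (intro path_prob_lower_low) simp
    with p show "0 < path_prob * ?p" by (intro mult_pos_pos[OF _ p]) linarith
  qed (rule triangle_prob_nonneg)
  also have "\<dots> \<le> (((ex Y) ^ 3 + 3 * (ex (\<lambda>k. high K k * (Y k)\<^sup>2) * (ex Y)\<^sup>2)
     + 4 ^ (K + s) * real K ^ 2 * \<delta> * (ex Y)\<^sup>2) / N\<^sup>2) / ?p"
    using p by (intro divide_right_mono triangle_prob_upper) simp
  finally show ?thesis
    using N_pos by (simp add: clustering_coeff_eq[OF n] power_divide)
qed

text \<open>In the low term the second moment stays in the denominator, which kills the term when
  that moment diverges; in the high term it cancels and leaves the squared tail of the first
  moment.\<close>

lemma clustering_coeff_upper_nonempty: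
  assumes n: "3 \<le> n" and E2: "0 < ex (\<lambda>k. (Y k)\<^sup>2)" and E0: "0 < ex (high 0)"
  shows "clustering_coeff n s m P \<le>
    (3 * (ex (\<lambda>k. low K k * (Y k)\<^sup>2) * (ex Y)\<^sup>2)
     + ex (\<lambda>k. (Y k)\<^sup>2) * (ex (\<lambda>k. high K k * Y k))\<^sup>2) / (ex (\<lambda>k. (Y k)\<^sup>2) * (ex (high 0))\<^sup>2)"
proof -
  let ?p = "ex (\<lambda>k. (Y k)\<^sup>2) * (ex (high 0) / N)\<^sup>2"
  have p: "0 < ?p" using E2 E0 N_pos by (intro mult_pos_pos zero_less_power divide_pos_pos)
  have "triangle_prob / path_prob \<le> triangle_prob / ?p"
  proof (rule divide_left_mono)
    show "?p \<le> path_prob" by (rule path_prob_lower_nonempty)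
    with p show "0 < path_prob * ?p" by (intro mult_pos_pos[OF _ p]) linarith
  qed (rule triangle_prob_nonneg)
  also have "\<dots> \<le> (3 * (ex (\<lambda>k. low K k * (Y k)\<^sup>2) * (ex Y / N)\<^sup>2)
     + ex (\<lambda>k. (Y k)\<^sup>2) * (ex (\<lambda>k. high K k * Y k) / N)\<^sup>2) / ?p"
    using p by (intro divide_right_mono triangle_prob_upper_nonempty) simp
  also have "\<dots> = ((3 * (ex (\<lambda>k. low K k * (Y k)\<^sup>2) * (ex Y)\<^sup>2)
     + ex (\<lambda>k. (Y k)\<^sup>2) * (ex (\<lambda>k. high K k * Y k))\<^sup>2) / N\<^sup>2) / (ex (\<lambda>k. (Y k)\<^sup>2) * (ex (high 0))\<^sup>2 / N\<^sup>2)"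
    by (simp add: power_divide add_divide_distrib)
  finally show ?thesis
    using N_pos by (simp add: clustering_coeff_eq[OF n])
qed

lemma clustering_coeff_nonneg: "0 \<le> clustering_coeff n s m P"
  by (simp add: clustering_coeff_def cond_prob_def)

end

section \<open>Weak convergence and tail expectations\<close>

text \<open>Weak convergence tested on bounded continuous functions, pulled back from the laws to
  the underlying spaces.\<close>

lemma weak_conv_expectation:
  fixes Q :: "nat \<Rightarrow> 'b pmf" and X :: "nat \<Rightarrow> 'b \<Rightarrow> real" and f :: "real \<Rightarrow> real"
  assumes M: "prob_space M" and Z: "Z \<in> borel_measurable M"
    and conv: "weak_conv_m (\<lambda>m. distr (measure_pmf (Q m)) borel (X m)) (distr M borel Z)"
    and f: "\<And>x. isCont f x" and B: "\<And>x. \<bar>f x\<bar> \<le> B"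
  shows "(\<lambda>m. measure_pmf.expectation (Q m) (\<lambda>k. f (X m k))) \<longlonglongrightarrow> (\<integral>\<omega>. f (Z \<omega>) \<partial>M)"
proof -
  have fm [measurable]: "f \<in> borel_measurable borel"
    using f by (intro borel_measurable_continuous_onI) (simp add: continuous_at_imp_continuous_on)
  have "(\<lambda>m. integral\<^sup>L (distr (measure_pmf (Q m)) borel (X m)) f) \<longlonglongrightarrow> integral\<^sup>L (distr M borel Z) f"
  proof (rule weak_conv_imp_integral_bdd_continuous_conv[OF _ _ conv])
    show "real_distribution (distr (measure_pmf (Q m)) borel (X m))" for m
      by (rule prob_space.real_distribution_distr[OF measure_pmf.prob_space_axioms]) simp
    show "real_distribution (distr M borel Z)"
      by (rule prob_space.real_distribution_distr[OF M Z])
  qed (use f B in auto)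
  then show ?thesis using Z by (simp add: integral_distr)
qed

lemma integral_min_tendsto:
  fixes f :: "'a \<Rightarrow> real"
  assumes "integrable M f" and "\<And>x. 0 \<le> f x"
  shows "(\<lambda>K. \<integral>x. min (f x) (real K) \<partial>M) \<longlonglongrightarrow> (\<integral>x. f x \<partial>M)"
proof (rule integral_dominated_convergence)
  show "AE x in M. (\<lambda>K. min (f x) (real K)) \<longlonglongrightarrow> f x"
  proof (rule AE_I2, rule tendsto_eventually)
    fix x
    show "\<forall>\<^sub>F K in sequentially. min (f x) (real K) = f x"
      using eventually_ge_at_top[of "nat \<lceil>f x\<rceil>"] by eventually_elim (simp add: min_absorb1 nat_ceiling_le_eq)
  qed
qed (use assms in auto)

text \<open>Uniform integrability. The mean of \<open>min \<phi> K\<close> converges by weak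
  convergence and the full mean by hypothesis, so the mean excess over \<open>K\<close> is
  eventually close to its limit, which is small for large \<open>K\<close>.\<close>

lemma weak_conv_tail_expectation:
  fixes Q :: "nat \<Rightarrow> 'b pmf" and X :: "nat \<Rightarrow> 'b \<Rightarrow> real" and \<phi> :: "real \<Rightarrow> real"
  assumes M: "prob_space M" and Z: "Z \<in> borel_measurable M"
    and conv: "weak_conv_m (\<lambda>m. distr (measure_pmf (Q m)) borel (X m)) (distr M borel Z)"
    and \<phi>: "\<And>x. isCont \<phi> x" "\<And>x. 0 \<le> \<phi> x"
    and int: "integrable M (\<lambda>\<omega>. \<phi> (Z \<omega>))"
    and intX: "\<forall>\<^sub>F m in sequentially. integrable (measure_pmf (Q m)) (\<lambda>k. \<phi> (X m k))"
    and lim: "(\<lambda>m. measure_pmf.expectation (Q m) (\<lambda>k. \<phi> (X m k))) \<longlonglongrightarrow> (\<integral>\<omega>. \<phi> (Z \<omega>) \<partial>M)"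
    and \<epsilon>: "0 < \<epsilon>"
  shows "\<exists>L\<ge>0. \<forall>\<^sub>F m in sequentially.
    measure_pmf.expectation (Q m) (\<lambda>k. of_bool (L < \<phi> (X m k)) * \<phi> (X m k)) \<le> \<epsilon>"
proof -
  let ?t = "\<integral>\<omega>. \<phi> (Z \<omega>) \<partial>M"
  have "(\<lambda>K. \<integral>\<omega>. min (\<phi> (Z \<omega>)) (real K) \<partial>M) \<longlonglongrightarrow> ?t"
    by (intro integral_min_tendsto int \<phi>)
  then have "\<forall>\<^sub>F K in sequentially. ?t - \<epsilon> / 4 < (\<integral>\<omega>. min (\<phi> (Z \<omega>)) (real K) \<partial>M)"
    by (rule order_tendstoD) (use \<epsilon> in simp)
  then obtain K :: nat where K: "?t - \<epsilon> / 4 < (\<integral>\<omega>. min (\<phi> (Z \<omega>)) (real K) \<partial>M)"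
    by (meson eventually_happens trivial_limit_sequentially)
  have "(\<lambda>m. measure_pmf.expectation (Q m) (\<lambda>k. min (\<phi> (X m k)) (real K)))
      \<longlonglongrightarrow> (\<integral>\<omega>. min (\<phi> (Z \<omega>)) (real K) \<partial>M)"
    using \<phi> by (intro weak_conv_expectation[OF M Z conv, where B = "real K"] continuous_min) auto
  then have "(\<lambda>m. measure_pmf.expectation (Q m) (\<lambda>k. \<phi> (X m k))
       - measure_pmf.expectation (Q m) (\<lambda>k. min (\<phi> (X m k)) (real K)))
      \<longlonglongrightarrow> ?t - (\<integral>\<omega>. min (\<phi> (Z \<omega>)) (real K) \<partial>M)"
    by (intro tendsto_diff lim)
  then have "\<forall>\<^sub>F m in sequentially. measure_pmf.expectation (Q m) (\<lambda>k. \<phi> (X m k))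
       - measure_pmf.expectation (Q m) (\<lambda>k. min (\<phi> (X m k)) (real K)) < \<epsilon> / 2"
    by (rule order_tendstoD) (use K \<epsilon> in linarith)
  \<comment> \<open>The threshold is doubled because \<open>\<phi> > 2 K\<close> gives
    \<open>\<phi> \<le> 2 (\<phi> - K)\<close>. The mean excess is below
    \<open>\<epsilon> / 4\<close> in the limit, hence eventually below
    \<open>\<epsilon> / 2\<close>.\<close>
  with intX have "\<forall>\<^sub>F m in sequentially.
    measure_pmf.expectation (Q m) (\<lambda>k. of_bool (2 * real K < \<phi> (X m k)) * \<phi> (X m k)) \<le> \<epsilon>"
  proof eventually_elim
    case (elim m)
    have i: "integrable (measure_pmf (Q m)) (\<lambda>k. min (\<phi> (X m k)) (real K))"
      using \<phi> by (intro measure_pmf.integrable_const_bound[where B = "real K"]) auto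
    have "measure_pmf.expectation (Q m) (\<lambda>k. of_bool (2 * real K < \<phi> (X m k)) * \<phi> (X m k))
       \<le> measure_pmf.expectation (Q m) (\<lambda>k. 2 * (\<phi> (X m k) - min (\<phi> (X m k)) (real K)))"
      using elim i \<phi>(2) by (intro integral_mono' integrable_mult_right Bochner_Integration.integrable_diff)
        (auto simp: of_bool_def min_def)
    also have "\<dots> = 2 * (measure_pmf.expectation (Q m) (\<lambda>k. \<phi> (X m k))
       - measure_pmf.expectation (Q m) (\<lambda>k. min (\<phi> (X m k)) (real K)))"
      using elim i by simp
    finally show ?case using elim(2) by argo
  qed
  then show ?thesis by (intro exI[of _ "2 * real K"]) simp
qed

text \<open>Monotone convergence provides a truncation level whose limiting mean exceeds a given
  \<open>c\<close>; weak convergence carries this to large \<open>m\<close>, and truncation only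
  lowers the mean.\<close>

lemma weak_conv_expectation_at_top:
  fixes Q :: "nat \<Rightarrow> 'b pmf" and X :: "nat \<Rightarrow> 'b \<Rightarrow> real" and \<phi> :: "real \<Rightarrow> real"
  assumes M: "prob_space M" and Z: "Z \<in> borel_measurable M"
    and conv: "weak_conv_m (\<lambda>m. distr (measure_pmf (Q m)) borel (X m)) (distr M borel Z)"
    and \<phi>: "\<And>x. isCont \<phi> x" "\<And>x. 0 \<le> \<phi> x"
    and inf: "(\<integral>\<^sup>+\<omega>. ennreal (\<phi> (Z \<omega>)) \<partial>M) = \<infinity>"
    and intX: "\<forall>\<^sub>F m in sequentially. integrable (measure_pmf (Q m)) (\<lambda>k. \<phi> (X m k))"
  shows "filterlim (\<lambda>m. measure_pmf.expectation (Q m) (\<lambda>k. \<phi> (X m k))) at_top sequentially"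
  unfolding filterlim_at_top_dense
proof
  fix c :: real
  interpret prob_space M by fact
  have [measurable]: "\<phi> \<in> borel_measurable borel"
    using \<phi> by (intro borel_measurable_continuous_onI) (simp add: continuous_at_imp_continuous_on)
  note Z [measurable]
  have i: "integrable M (\<lambda>\<omega>. min (\<phi> (Z \<omega>)) (real K))" for K :: nat
    using \<phi> by (intro integrable_const_bound[where B = "real K"]) auto
  have "(\<lambda>K. \<integral>\<^sup>+\<omega>. ennreal (min (\<phi> (Z \<omega>)) (real K)) \<partial>M) \<longlonglongrightarrow> (\<integral>\<^sup>+\<omega>. ennreal (\<phi> (Z \<omega>)) \<partial>M)"
  proof (rule nn_integral_LIMSEQ)
    show "incseq (\<lambda>K \<omega>. ennreal (min (\<phi> (Z \<omega>)) (real K)))"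
      by (auto simp: incseq_def le_fun_def intro!: ennreal_leI)
    show "(\<lambda>K. ennreal (min (\<phi> (Z \<omega>)) (real K))) \<longlonglongrightarrow> ennreal (\<phi> (Z \<omega>))" for \<omega>
    proof (rule tendsto_eventually)
      show "\<forall>\<^sub>F K in sequentially. ennreal (min (\<phi> (Z \<omega>)) (real K)) = ennreal (\<phi> (Z \<omega>))"
        using eventually_ge_at_top[of "nat \<lceil>\<phi> (Z \<omega>)\<rceil>"]
        by eventually_elim (simp add: min_absorb1 nat_ceiling_le_eq)
    qed
  qed auto
  then have "\<forall>\<^sub>F K in sequentially. ennreal c < (\<integral>\<^sup>+\<omega>. ennreal (min (\<phi> (Z \<omega>)) (real K)) \<partial>M)"
    unfolding inf by (rule order_tendstoD) simp
  then obtain K :: nat where "ennreal c < (\<integral>\<^sup>+\<omega>. ennreal (min (\<phi> (Z \<omega>)) (real K)) \<partial>M)"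
    by (meson eventually_happens trivial_limit_sequentially)
  also have "\<dots> = ennreal (\<integral>\<omega>. min (\<phi> (Z \<omega>)) (real K) \<partial>M)"
    using \<phi> by (intro nn_integral_eq_integral i) auto
  finally have K: "c < (\<integral>\<omega>. min (\<phi> (Z \<omega>)) (real K) \<partial>M)"
    by (metis ennreal_leI not_le)
  have "(\<lambda>m. measure_pmf.expectation (Q m) (\<lambda>k. min (\<phi> (X m k)) (real K)))
      \<longlonglongrightarrow> (\<integral>\<omega>. min (\<phi> (Z \<omega>)) (real K) \<partial>M)"
    using \<phi> by (intro weak_conv_expectation[OF M Z conv, where B = "real K"] continuous_min) auto
  then have "\<forall>\<^sub>F m in sequentially. c < measure_pmf.expectation (Q m) (\<lambda>k. min (\<phi> (X m k)) (real K))"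
    using K by (rule order_tendstoD)
  with intX show "\<forall>\<^sub>F m in sequentially. c < measure_pmf.expectation (Q m) (\<lambda>k. \<phi> (X m k))"
  proof eventually_elim
    case (elim m)
    have "measure_pmf.expectation (Q m) (\<lambda>k. min (\<phi> (X m k)) (real K))
        \<le> measure_pmf.expectation (Q m) (\<lambda>k. \<phi> (X m k))"
      using elim \<phi>(2) by (intro integral_mono') auto
    then show ?case using elim by simp
  qed
qed

text \<open>The test function is bounded, continuous and positive exactly on the negative axis; its
  means vanish along the sequence, hence in the limit.\<close>

lemma weak_conv_nonneg_limit:
  fixes Q :: "nat \<Rightarrow> 'b pmf" and X :: "nat \<Rightarrow> 'b \<Rightarrow> real"
  assumes M: "prob_space M" and Z: "Z \<in> borel_measurable M"
    and conv: "weak_conv_m (\<lambda>m. distr (measure_pmf (Q m)) borel (X m)) (distr M borel Z)"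
    and X: "\<And>m k. 0 \<le> X m k"
  shows "AE \<omega> in M. 0 \<le> Z \<omega>"
proof -
  interpret prob_space M by fact
  note Z [measurable]
  let ?f = "\<lambda>x::real. min (max (- x) 0) 1"
  have "(\<lambda>m. measure_pmf.expectation (Q m) (\<lambda>k. ?f (X m k))) \<longlonglongrightarrow> (\<integral>\<omega>. ?f (Z \<omega>) \<partial>M)"
    by (intro weak_conv_expectation[OF M Z conv, where B = 1] continuous_min continuous_max continuous_intros) auto
  moreover have "?f (X m k) = 0" for m k using X[of m k] by simp
  ultimately have "(\<integral>\<omega>. ?f (Z \<omega>) \<partial>M) = 0"
    by (simp add: LIMSEQ_const_iff)
  moreover have "integrable M (\<lambda>\<omega>. ?f (Z \<omega>))"
    by (intro integrable_const_bound[where B = 1]) auto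
  ultimately have "AE \<omega> in M. ?f (Z \<omega>) = 0"
    by (subst (asm) integral_nonneg_eq_0_iff_AE) auto
  then show ?thesis by eventually_elim (auto simp: min_def max_def split: if_splits)
qed

section \<open>Asymptotics of the clustering coefficient\<close>

text \<open>A sandwich in two stages: for each \<open>\<epsilon>\<close> the bounds \<open>l\<close>
  and \<open>u\<close> may involve a cut-off chosen from \<open>\<epsilon>\<close>, and only their
  limits have to agree as \<open>\<epsilon>\<close> tends to \<open>0\<close>.\<close>

lemma tendsto_squeeze_family:
  fixes x :: "nat \<Rightarrow> real" and f g :: "real \<Rightarrow> real"
  assumes f: "(f \<longlongrightarrow> L) (at_right 0)" and g: "(g \<longlongrightarrow> L) (at_right 0)"
    and lu: "\<forall>\<^sub>F \<epsilon> in at_right 0. \<exists>l u. l \<longlonglongrightarrow> f \<epsilon> \<and> u \<longlonglongrightarrow> g \<epsilon> \<and> (\<forall>\<^sub>F m in sequentially. l m \<le> x m \<and> x m \<le> u m)"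
  shows "x \<longlonglongrightarrow> L"
proof (rule order_tendstoI)
  fix a assume "a < L"
  with f have "\<forall>\<^sub>F \<epsilon> in at_right 0. a < f \<epsilon>" by (rule order_tendstoD)
  with lu have "\<exists>\<epsilon>. (\<exists>l u. l \<longlonglongrightarrow> f \<epsilon> \<and> u \<longlonglongrightarrow> g \<epsilon> \<and> (\<forall>\<^sub>F m in sequentially. l m \<le> x m \<and> x m \<le> u m)) \<and> a < f \<epsilon>"
    by (intro eventually_happens'[OF trivial_limit_at_right_real] eventually_conj)
  then obtain \<epsilon> l u where l: "l \<longlonglongrightarrow> f \<epsilon>" "a < f \<epsilon>" "\<forall>\<^sub>F m in sequentially. l m \<le> x m \<and> x m \<le> u m"
    by blast
  from order_tendstoD(1)[OF l(1,2)] l(3) show "\<forall>\<^sub>F m in sequentially. a < x m"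
    by eventually_elim linarith
next
  fix a assume "L < a"
  with g have "\<forall>\<^sub>F \<epsilon> in at_right 0. g \<epsilon> < a" by (rule order_tendstoD)
  with lu have "\<exists>\<epsilon>. (\<exists>l u. l \<longlonglongrightarrow> f \<epsilon> \<and> u \<longlonglongrightarrow> g \<epsilon> \<and> (\<forall>\<^sub>F m in sequentially. l m \<le> x m \<and> x m \<le> u m)) \<and> g \<epsilon> < a"
    by (intro eventually_happens'[OF trivial_limit_at_right_real] eventually_conj)
  then obtain \<epsilon> l u where u: "u \<longlonglongrightarrow> g \<epsilon>" "g \<epsilon> < a" "\<forall>\<^sub>F m in sequentially. l m \<le> x m \<and> x m \<le> u m"
    by blast
  from order_tendstoD(2)[OF u(1,2)] u(3) show "\<forall>\<^sub>F m in sequentially. x m < a"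
    by eventually_elim linarith
qed

lemma overlap_ratio_tendsto_0:
  assumes "\<forall>\<^sub>F m in sequentially. s m \<le> (S::nat)"
  shows "(\<lambda>m. overlap_ratio m (s m)) \<longlonglongrightarrow> 0"
proof (rule tendsto_sandwich[of "\<lambda>_. 0"])
  have ev: "\<forall>\<^sub>F m in sequentially. s m \<le> S \<and> S < m"
    using assms eventually_gt_at_top[of S] by eventually_elim simp
  then show "\<forall>\<^sub>F m in sequentially. 0 \<le> overlap_ratio m (s m)"
    by eventually_elim (auto simp: overlap_ratio_def)
  show "\<forall>\<^sub>F m in sequentially. overlap_ratio m (s m) \<le> (real S + 1) / (real m - real S)"
    using ev by eventually_elim (auto simp: overlap_ratio_def intro!: frac_le)
  show "(\<lambda>m. (real S + 1) / (real m - real S)) \<longlonglongrightarrow> 0"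
    using filterlim_tendsto_add_at_top[OF tendsto_const filterlim_real_sequentially, of "- real S"]
    by (intro tendsto_divide_0[OF tendsto_const] filterlim_at_top_imp_at_infinity) simp
qed simp

section \<open>Limits in terms of the unnormalised subset count\<close>

context
  fixes n s :: "nat \<Rightarrow> nat" and P :: "nat \<Rightarrow> nat pmf" and S :: nat and \<mu> :: real
  assumes model: "\<forall>\<^sub>F m in sequentially. random_attribute_set m (s m) (P m)"
    and n3: "\<forall>\<^sub>F m in sequentially. 3 \<le> n m"
    and sS: "\<forall>\<^sub>F m in sequentially. s m \<le> S"
    and mean: "(\<lambda>m. measure_pmf.expectation (P m) (subset_count (s m))) \<longlonglongrightarrow> \<mu>"
    and \<mu>: "0 < \<mu>"
begin

text \<open>For given \<open>\<epsilon>\<close> a cut-off \<open>K\<close> makes the tail of the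
  second moment at most \<open>\<epsilon>\<close>. With \<open>K\<close> fixed, all errors
  containing \<open>\<delta>\<close> vanish as \<open>m\<close> grows, and the limiting bounds
  differ from \<open>\<mu> / \<sigma>\<close> only through \<open>\<epsilon>\<close>.\<close>

lemma clustering_coeff_tendsto:
  assumes mean2: "(\<lambda>m. measure_pmf.expectation (P m) (\<lambda>k. (subset_count (s m) k)\<^sup>2)) \<longlonglongrightarrow> \<sigma>"
    and \<sigma>: "0 < \<sigma>"
    and tail: "\<And>\<epsilon>. 0 < \<epsilon> \<Longrightarrow> \<exists>K. \<forall>\<^sub>F m in sequentially.
      measure_pmf.expectation (P m) (\<lambda>k. high_count (s m) K k * (subset_count (s m) k)\<^sup>2) \<le> \<epsilon>"
  shows "(\<lambda>m. clustering_coeff (n m) (s m) m (P m)) \<longlonglongrightarrow> \<mu> / \<sigma>"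
proof (rule tendsto_squeeze_family)
  let ?f = "\<lambda>\<epsilon>. (\<mu> - \<epsilon>) ^ 3 / (\<sigma> * \<mu>\<^sup>2)"
  let ?g = "\<lambda>\<epsilon>. (\<mu> ^ 3 + 3 * (\<epsilon> * \<mu>\<^sup>2)) / ((\<sigma> - \<epsilon>) * (\<mu> - \<epsilon>)\<^sup>2)"
  have "(?f \<longlongrightarrow> (\<mu> - 0) ^ 3 / (\<sigma> * \<mu>\<^sup>2)) (at_right 0)"
    using \<mu> \<sigma> by (intro tendsto_intros) auto
  then show "(?f \<longlongrightarrow> \<mu> / \<sigma>) (at_right 0)"
    using \<mu> by (simp add: power3_eq_cube power2_eq_square)
  have "(?g \<longlongrightarrow> (\<mu> ^ 3 + 3 * (0 * \<mu>\<^sup>2)) / ((\<sigma> - 0) * (\<mu> - 0)\<^sup>2)) (at_right 0)"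
    using \<mu> \<sigma> by (intro tendsto_intros) auto
  then show "(?g \<longlongrightarrow> \<mu> / \<sigma>) (at_right 0)"
    using \<mu> by (simp add: power3_eq_cube power2_eq_square)
  have "\<forall>\<^sub>F \<epsilon> in at_right (0::real). 0 < \<epsilon> \<and> \<epsilon> < \<mu> \<and> \<epsilon> < \<sigma>"
    unfolding eventually_at_right_field using \<mu> \<sigma> by (intro exI[of _ "min \<mu> \<sigma>"]) simp
  then show "\<forall>\<^sub>F \<epsilon> in at_right 0. \<exists>l u. l \<longlonglongrightarrow> ?f \<epsilon> \<and> u \<longlonglongrightarrow> ?g \<epsilon> \<and>
    (\<forall>\<^sub>F m in sequentially. l m \<le> clustering_coeff (n m) (s m) m (P m) \<and> clustering_coeff (n m) (s m) m (P m) \<le> u m)"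
  proof eventually_elim
    case (elim \<epsilon>)
    then obtain K where K: "\<forall>\<^sub>F m in sequentially.
      measure_pmf.expectation (P m) (\<lambda>k. high_count (s m) K k * (subset_count (s m) k)\<^sup>2) \<le> \<epsilon>"
      using tail by blast
    define E1 where "E1 m = measure_pmf.expectation (P m) (subset_count (s m))" for m
    define E2 where "E2 m = measure_pmf.expectation (P m) (\<lambda>k. (subset_count (s m) k)\<^sup>2)" for m
    define \<delta> where "\<delta> m = overlap_ratio m (s m)" for m
    have E1: "E1 \<longlonglongrightarrow> \<mu>" and E2: "E2 \<longlonglongrightarrow> \<sigma>" using mean mean2 by (simp_all add: E1_def[abs_def] E2_def[abs_def])
    have \<delta>: "\<delta> \<longlonglongrightarrow> 0" using overlap_ratio_tendsto_0[OF sS] by (simp add: \<delta>_def[abs_def])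
    \<comment> \<open>\<open>l\<close> and \<open>u\<close> come from
      \<open>clustering_coeff_lower\<close> and \<open>clustering_coeff_upper\<close>: truncated
      moments become \<open>E1 - \<epsilon>\<close> and \<open>E2 - \<epsilon>\<close>, the tail
      becomes \<open>\<epsilon>\<close>, and \<open>s m\<close> becomes \<open>S\<close>.\<close>
    define l where "l m = ((E1 m - \<epsilon>) ^ 3 - real K ^ 7 * (\<delta> m)\<^sup>2) / (E2 m * (E1 m)\<^sup>2)" for m
    define u where "u m = ((E1 m) ^ 3 + 3 * (\<epsilon> * (E1 m)\<^sup>2) + 4 ^ (K + S) * real K ^ 2 * \<delta> m * (E1 m)\<^sup>2)
       / ((E2 m - \<epsilon>) * (E1 m - \<epsilon> - real K ^ 4 * \<delta> m)\<^sup>2)" for m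
    have "l \<longlonglongrightarrow> ((\<mu> - \<epsilon>) ^ 3 - real K ^ 7 * 0\<^sup>2) / (\<sigma> * \<mu>\<^sup>2)"
      unfolding l_def using \<mu> \<sigma> by (intro tendsto_intros E1 E2 \<delta>) auto
    then have l: "l \<longlonglongrightarrow> ?f \<epsilon>" by simp
    have "u \<longlonglongrightarrow> (\<mu> ^ 3 + 3 * (\<epsilon> * \<mu>\<^sup>2) + 4 ^ (K + S) * real K ^ 2 * 0 * \<mu>\<^sup>2)
       / ((\<sigma> - \<epsilon>) * (\<mu> - \<epsilon> - real K ^ 4 * 0)\<^sup>2)"
      unfolding u_def using \<mu> \<sigma> elim by (intro tendsto_intros E1 E2 \<delta>) auto
    then have u: "u \<longlonglongrightarrow> ?g \<epsilon>" by simp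
    have "(\<lambda>m. E1 m - \<epsilon> - real K ^ 4 * \<delta> m) \<longlonglongrightarrow> \<mu> - \<epsilon> - real K ^ 4 * 0"
      by (intro tendsto_intros E1 \<delta>)
    then have ev1: "\<forall>\<^sub>F m in sequentially. 0 < E1 m - \<epsilon> - real K ^ 4 * \<delta> m"
      by (rule order_tendstoD) (use elim in simp)
    have ev2: "\<forall>\<^sub>F m in sequentially. \<epsilon> < E2 m"
      using E2 by (rule order_tendstoD) (use elim in simp)
    have "\<forall>\<^sub>F m in sequentially. l m \<le> clustering_coeff (n m) (s m) m (P m) \<and> clustering_coeff (n m) (s m) m (P m) \<le> u m"
      using model n3 sS K ev1 ev2
    proof eventually_elim
      case (elim m)
      interpret random_attribute_set m "s m" "P m" by (rule elim(1))
      let ?F1 = "ex (\<lambda>k. low K k * Y k)" and ?F2 = "ex (\<lambda>k. low K k * (Y k)\<^sup>2)"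
      let ?G1 = "ex (\<lambda>k. high K k * Y k)" and ?G2 = "ex (\<lambda>k. high K k * (Y k)\<^sup>2)"
      have \<delta>0: "0 \<le> \<delta> m" unfolding \<delta>_def by (rule overlap_ratio_nonneg)
      \<comment> \<open>\<open>Y\<close> takes natural values, so \<open>Y \<le> Y\<^sup>2\<close>
        and one cut-off controls both moments.\<close>
      have "?G1 \<le> ?G2"
        by (intro ex_mono) (auto simp: high_count_def subset_count_def power2_eq_square simp flip: of_nat_mult)
      moreover have "?F1 + ?G1 = E1 m"
        unfolding E1_def ex_add[symmetric] by (simp add: low_add_high flip: distrib_right)
      ultimately have F1: "E1 m - \<epsilon> \<le> ?F1" using elim(4) by linarith
      have "?F2 + ?G2 = E2 m"
        unfolding E2_def ex_add[symmetric] by (simp add: low_add_high flip: distrib_right)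
      then have F2: "E2 m - \<epsilon> \<le> ?F2" using elim(4) by linarith
      have F1p: "0 < ?F1 - real K ^ 4 * \<delta> m" and F2p: "0 < ?F2" and \<epsilon>1: "0 < E1 m - \<epsilon>"
        using F1 F2 elim(5,6) mult_nonneg_nonneg[OF _ \<delta>0, of "real K ^ 4"] by auto
      have E1p: "0 < E1 m" using \<epsilon>1 \<open>0 < \<epsilon> \<and> \<epsilon> < \<mu> \<and> \<epsilon> < \<sigma>\<close> by simp
      have "l m \<le> (?F1 ^ 3 - real K ^ 7 * (\<delta> m)\<^sup>2) / (E2 m * (E1 m)\<^sup>2)"
        unfolding l_def using F1 \<epsilon>1 elim(6) \<open>0 < \<epsilon> \<and> \<epsilon> < \<mu> \<and> \<epsilon> < \<sigma>\<close>
        by (intro divide_right_mono diff_right_mono power_mono) auto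
      also have "\<dots> \<le> clustering_coeff (n m) (s m) m (P m)"
        using clustering_coeff_lower[OF elim(2), of K] F1p F2p E1p by (simp add: E1_def E2_def \<delta>_def)
      finally have lower: "l m \<le> clustering_coeff (n m) (s m) m (P m)" .
      have "clustering_coeff (n m) (s m) m (P m) \<le>
         ((E1 m) ^ 3 + 3 * (?G2 * (E1 m)\<^sup>2) + 4 ^ (K + s m) * real K ^ 2 * \<delta> m * (E1 m)\<^sup>2)
         / (?F2 * (?F1 - real K ^ 4 * \<delta> m)\<^sup>2)"
        using clustering_coeff_upper[OF elim(2), of K] F1p F2p by (simp add: E1_def \<delta>_def)
      also have "\<dots> \<le> u m"
        unfolding u_def
      proof (rule frac_le)
        show "(E1 m) ^ 3 + 3 * (?G2 * (E1 m)\<^sup>2) + 4 ^ (K + s m) * real K ^ 2 * \<delta> m * (E1 m)\<^sup>2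
          \<le> (E1 m) ^ 3 + 3 * (\<epsilon> * (E1 m)\<^sup>2) + 4 ^ (K + S) * real K ^ 2 * \<delta> m * (E1 m)\<^sup>2"
        proof -
          have "?G2 * (E1 m)\<^sup>2 \<le> \<epsilon> * (E1 m)\<^sup>2"
            using elim(4) by (intro mult_right_mono) auto
          moreover have "(4::real) ^ (K + s m) \<le> 4 ^ (K + S)"
            using elim(3) by (intro power_increasing) auto
          then have "4 ^ (K + s m) * real K ^ 2 * \<delta> m * (E1 m)\<^sup>2 \<le> 4 ^ (K + S) * real K ^ 2 * \<delta> m * (E1 m)\<^sup>2"
            using \<delta>0 by (intro mult_right_mono) auto
          ultimately show ?thesis by linarith
        qed
        show "0 < (E2 m - \<epsilon>) * (E1 m - \<epsilon> - real K ^ 4 * \<delta> m)\<^sup>2"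
          using elim(5,6) by simp
        show "(E2 m - \<epsilon>) * (E1 m - \<epsilon> - real K ^ 4 * \<delta> m)\<^sup>2 \<le> ?F2 * (?F1 - real K ^ 4 * \<delta> m)\<^sup>2"
          using F1 F2 F2p elim(5,6) by (intro mult_mono power_mono) auto
        show "0 \<le> (E1 m) ^ 3 + 3 * (\<epsilon> * (E1 m)\<^sup>2) + 4 ^ (K + S) * real K ^ 2 * \<delta> m * (E1 m)\<^sup>2"
          using E1p \<delta>0 \<open>0 < \<epsilon> \<and> \<epsilon> < \<mu> \<and> \<epsilon> < \<sigma>\<close> by simp
      qed
      finally show ?case using lower by simp
    qed
    with l u show ?case by blast
  qed
qed

text \<open>With \<open>K\<close> chosen from \<open>\<epsilon>\<close>, the low contribution is of
  order \<open>K\<^sup>2 / E2\<close> and vanishes; the high one is at most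
  \<open>\<epsilon>\<^sup>2 / p\<^sup>2\<close>, where \<open>p\<close> bounds the probability of
  \<open>Y > 0\<close> from below.\<close>

lemma clustering_coeff_tendsto_0:
  assumes mean2: "filterlim (\<lambda>m. measure_pmf.expectation (P m) (\<lambda>k. (subset_count (s m) k)\<^sup>2)) at_top sequentially"
    and tail: "\<And>\<epsilon>. 0 < \<epsilon> \<Longrightarrow> \<exists>K. \<forall>\<^sub>F m in sequentially.
      measure_pmf.expectation (P m) (\<lambda>k. high_count (s m) K k * subset_count (s m) k) \<le> \<epsilon>"
  shows "(\<lambda>m. clustering_coeff (n m) (s m) m (P m)) \<longlonglongrightarrow> 0"
proof -
  define E1 where "E1 m = measure_pmf.expectation (P m) (subset_count (s m))" for m
  define E2 where "E2 m = measure_pmf.expectation (P m) (\<lambda>k. (subset_count (s m) k)\<^sup>2)" for m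
  have E1: "E1 \<longlonglongrightarrow> \<mu>" using mean by (simp add: E1_def[abs_def])
  have E2: "filterlim E2 at_top sequentially" using mean2 by (simp add: E2_def[abs_def])
  obtain K0 where K0: "\<forall>\<^sub>F m in sequentially.
      measure_pmf.expectation (P m) (\<lambda>k. high_count (s m) K0 k * subset_count (s m) k) \<le> \<mu> / 4"
    using tail[of "\<mu> / 4"] \<mu> by auto
  \<comment> \<open>Eventually \<open>\<mu> / 2 < E Y \<le> (K0 + 1) P(Y > 0) + \<mu> / 4\<close>,
    which gives this lower bound for \<open>P(Y > 0)\<close>. The \<open>+ 1\<close> keeps it
    meaningful for \<open>K0 = 0\<close>.\<close>
  define p where "p = \<mu> / (4 * (real K0 + 1))"
  have p: "0 < p" using \<mu> by (simp add: p_def)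
  have "\<forall>\<^sub>F m in sequentially. \<mu> / 2 < E1 m"
    using E1 by (rule order_tendstoD) (use \<mu> in simp)
  with model K0 have high0: "\<forall>\<^sub>F m in sequentially. p \<le> measure_pmf.expectation (P m) (high_count (s m) 0)"
  proof eventually_elim
    case (elim m)
    interpret random_attribute_set m "s m" "P m" by (rule elim(1))
    have "E1 m \<le> ex (\<lambda>k. (real K0 + 1) * high 0 k + high K0 k * Y k)"
      unfolding E1_def
    proof (rule ex_mono)
      fix k
      show "Y k \<le> (real K0 + 1) * high 0 k + high K0 k * Y k"
        by (simp add: subset_count_def high_count_def of_bool_def)
    qed
    also have "\<dots> = (real K0 + 1) * ex (high 0) + ex (\<lambda>k. high K0 k * Y k)"
      by (simp only: ex_add ex_cmult)
    finally have "\<mu> / 4 \<le> (real K0 + 1) * ex (high 0)" using elim(2,3) by linarith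
    then show ?case by (simp add: p_def field_simps)
  qed
  show ?thesis
  proof (rule tendsto_squeeze_family)
    show "((\<lambda>_. 0) \<longlongrightarrow> 0) (at_right (0::real))" by simp
    have "((\<lambda>\<epsilon>. \<epsilon>\<^sup>2 / p\<^sup>2) \<longlongrightarrow> 0\<^sup>2 / p\<^sup>2) (at_right 0)"
      using p by (intro tendsto_intros) auto
    then show "((\<lambda>\<epsilon>. \<epsilon>\<^sup>2 / p\<^sup>2) \<longlongrightarrow> 0) (at_right 0)" by simp
    show "\<forall>\<^sub>F \<epsilon> in at_right 0. \<exists>l u. l \<longlonglongrightarrow> 0 \<and> u \<longlonglongrightarrow> \<epsilon>\<^sup>2 / p\<^sup>2 \<and>
      (\<forall>\<^sub>F m in sequentially. l m \<le> clustering_coeff (n m) (s m) m (P m) \<and> clustering_coeff (n m) (s m) m (P m) \<le> u m)"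
      using eventually_at_right_less[of "0::real"]
    proof eventually_elim
      case (elim \<epsilon>)
      then obtain K where K: "\<forall>\<^sub>F m in sequentially.
        measure_pmf.expectation (P m) (\<lambda>k. high_count (s m) K k * subset_count (s m) k) \<le> \<epsilon>"
        using tail by blast
      define u where "u m = 3 * (real K)\<^sup>2 * (E1 m)\<^sup>2 * inverse (E2 m) / p\<^sup>2 + \<epsilon>\<^sup>2 / p\<^sup>2" for m
      have "u \<longlonglongrightarrow> 3 * (real K)\<^sup>2 * \<mu>\<^sup>2 * 0 / p\<^sup>2 + \<epsilon>\<^sup>2 / p\<^sup>2"
        unfolding u_def using p
        by (intro tendsto_add tendsto_divide tendsto_mult tendsto_power tendsto_const E1
              tendsto_inverse_0_at_top[OF E2]) auto
      then have u: "u \<longlonglongrightarrow> \<epsilon>\<^sup>2 / p\<^sup>2" by simp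
      have "\<forall>\<^sub>F m in sequentially. 0 < E2 m"
        using E2 by (simp add: filterlim_at_top_dense)
      with model n3 K high0
      have "\<forall>\<^sub>F m in sequentially. 0 \<le> clustering_coeff (n m) (s m) m (P m) \<and> clustering_coeff (n m) (s m) m (P m) \<le> u m"
      proof eventually_elim
        case (elim m)
        interpret random_attribute_set m "s m" "P m" by (rule elim(1))
        let ?F2 = "ex (\<lambda>k. low K k * (Y k)\<^sup>2)" and ?G1 = "ex (\<lambda>k. high K k * Y k)"
        have "?F2 \<le> ex (\<lambda>k. (real K)\<^sup>2)"
          by (intro ex_mono) (auto simp: low_count_def subset_count_def intro!: power_mono)
        then have F2: "?F2 \<le> (real K)\<^sup>2" by simp
        have G1: "0 \<le> ?G1"
          by (intro Bochner_Integration.integral_nonneg) (simp add: high_count_nonneg subset_count_nonneg)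
        have "clustering_coeff (n m) (s m) m (P m) \<le>
          (3 * (?F2 * (E1 m)\<^sup>2) + E2 m * ?G1\<^sup>2) / (E2 m * (ex (high 0))\<^sup>2)"
          using clustering_coeff_upper_nonempty[OF elim(2), of K] elim(4,5) p by (simp add: E1_def E2_def)
        also have "\<dots> \<le> (3 * ((real K)\<^sup>2 * (E1 m)\<^sup>2) + E2 m * \<epsilon>\<^sup>2) / (E2 m * p\<^sup>2)"
        proof (rule frac_le)
          show "3 * (?F2 * (E1 m)\<^sup>2) + E2 m * ?G1\<^sup>2 \<le> 3 * ((real K)\<^sup>2 * (E1 m)\<^sup>2) + E2 m * \<epsilon>\<^sup>2"
            using F2 G1 elim(3,5) by (intro add_mono mult_left_mono mult_right_mono power_mono) simp_all
          show "E2 m * p\<^sup>2 \<le> E2 m * (ex (high 0))\<^sup>2"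
            using elim(4,5) p by (intro mult_left_mono power_mono) simp_all
        qed (use elim(5) p in simp_all)
        also have "\<dots> = u m"
          using elim(5) p by (simp add: u_def field_simps)
        finally show ?case using clustering_coeff_nonneg by simp
      qed
      with u show ?case by (intro exI[of _ "\<lambda>_. 0"] exI[of _ u]) simp
    qed
  qed
qed

end

section \<open>Rescaling between the subset count and \<open>Zvar\<close>, and the theorem\<close>

lemma Zvar_eq_subset_count:
  "Zvar n s m x = subset_count s x * (real (m choose s) powr (-1/2) * real n powr (1/2))"
  by (simp add: Zvar_def subset_count_def)

text \<open>On \<open>Y > K\<close> the choice of \<open>K\<close> gives
  \<open>c Y \<ge> L + 1\<close>. The \<open>+ 1\<close> ensures \<open>c Y \<ge> 1\<close>, so its
  \<open>q\<close>-th power also exceeds \<open>L\<close>; the tail of \<open>Y ^ q\<close> is thus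
  at most that of \<open>(c Y) ^ q\<close> divided by \<open>c0 ^ q\<close>.\<close>

lemma tail_rescale:
  assumes P: "finite (set_pmf P)" and c: "0 < c0" "c0 \<le> c" and K: "L + 1 \<le> c0 * real K"
    and q: "q = 1 \<or> q = 2"
    and tail: "measure_pmf.expectation P (\<lambda>k. of_bool (L < (c * subset_count s k) ^ q) * (c * subset_count s k) ^ q) \<le> c0 ^ q * \<epsilon>"
    and L: "0 \<le> L"
  shows "measure_pmf.expectation P (\<lambda>k. high_count s K k * subset_count s k ^ q) \<le> \<epsilon>"
proof -
  have "measure_pmf.expectation P (\<lambda>k. c0 ^ q * (high_count s K k * subset_count s k ^ q))
    \<le> measure_pmf.expectation P (\<lambda>k. of_bool (L < (c * subset_count s k) ^ q) * (c * subset_count s k) ^ q)"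
  proof (rule integral_mono)
    fix k
    show "c0 ^ q * (high_count s K k * subset_count s k ^ q)
      \<le> of_bool (L < (c * subset_count s k) ^ q) * (c * subset_count s k) ^ q"
    proof (cases "K < k choose s")
      case True
      then have "c0 * real K \<le> c * subset_count s k"
        using c by (intro mult_mono) (auto simp: subset_count_def)
      then have 1: "L + 1 \<le> c * subset_count s k" using K by linarith
      then have "c * subset_count s k \<le> (c * subset_count s k) ^ q"
        using q L by (auto simp: self_le_power)
      with 1 have "L < (c * subset_count s k) ^ q" by linarith
      moreover have "c0 ^ q * subset_count s k ^ q \<le> (c * subset_count s k) ^ q"
        using c by (simp add: power_mult_distrib mult_right_mono power_mono subset_count_def)
      ultimately show ?thesis using True by (simp add: high_count_def)
    next
      case False
      have "0 \<le> (c * subset_count s k) ^ q" using c by (simp add: subset_count_def)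
      then show ?thesis using False by (simp add: high_count_def)
    qed
  qed (use P in \<open>auto intro: integrable_measure_pmf_finite\<close>)
  then have "c0 ^ q * measure_pmf.expectation P (\<lambda>k. high_count s K k * subset_count s k ^ q) \<le> c0 ^ q * \<epsilon>"
    using tail by simp
  then show ?thesis using c by simp
qed

theorem theorem2p3:
  fixes \<beta> :: real
    and n s :: "nat \<Rightarrow> nat"
    and P :: "nat \<Rightarrow> nat pmf"
    and M :: "'a measure"
    and Z :: "'a \<Rightarrow> real"
  assumes "\<beta> > 0"
    and "\<And>m. 1 \<le> m \<Longrightarrow> 1 \<le> s m \<and> s m \<le> m"
    and "\<And>m. 1 \<le> m \<Longrightarrow> set_pmf (P m) \<subseteq> {0..m}"
    and "(\<lambda>m. real (s m)) \<in> O(\<lambda>_. 1)"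
    and "(\<lambda>m. real (m choose s m) / real (n m)) \<longlonglongrightarrow> \<beta>"
    and "prob_space M"
    and "Z \<in> borel_measurable M"
    and "weak_conv_m (\<lambda>m. distr (measure_pmf (P m)) borel (Zvar (n m) (s m) m)) (distr M borel Z)"
    and "integrable M Z"
    and "(\<lambda>m. measure_pmf.expectation (P m) (Zvar (n m) (s m) m)) \<longlonglongrightarrow> (\<integral>\<omega>. Z \<omega> \<partial>M)"
  shows
    "(integrable M (\<lambda>\<omega>. (Z \<omega>)\<^sup>2) \<and> 0 < (\<integral>\<omega>. (Z \<omega>)\<^sup>2 \<partial>M) \<and>
      (\<lambda>m. measure_pmf.expectation (P m) (\<lambda>x. (Zvar (n m) (s m) m x)\<^sup>2)) \<longlonglongrightarrow> (\<integral>\<omega>. (Z \<omega>)\<^sup>2 \<partial>M)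
      \<longrightarrow> (\<lambda>m. clustering_coeff (n m) (s m) m (P m)
               - 1 / sqrt \<beta> * ((\<integral>\<omega>. Z \<omega> \<partial>M) / (\<integral>\<omega>. (Z \<omega>)\<^sup>2 \<partial>M))) \<in> o(\<lambda>_. 1))
     \<and> ((\<integral>\<^sup>+\<omega>. ennreal ((Z \<omega>)\<^sup>2) \<partial>M) = \<infinity>
      \<longrightarrow> (\<lambda>m. clustering_coeff (n m) (s m) m (P m)) \<in> o(\<lambda>_. 1))"
proof -
  note \<beta> = assms(1) and ratio = assms(5) and M = assms(6) and Z [measurable] = assms(7) and conv = assms(8)
  interpret prob_space M by (rule M)
  let ?X = "\<lambda>m. Zvar (n m) (s m) m"
  let ?Y = "\<lambda>m. subset_count (s m)"
  let ?E = "\<lambda>m. measure_pmf.expectation (P m)"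
  obtain C where "\<forall>\<^sub>F m in sequentially. norm (real (s m)) \<le> C * norm (1::real)"
    using assms(4) by (elim landau_o.bigE)
  then have sS: "\<forall>\<^sub>F m in sequentially. s m \<le> nat \<lceil>C\<rceil>"
  proof eventually_elim
    case (elim m)
    then have "real (s m) \<le> C" by simp
    also have "\<dots> \<le> real (nat \<lceil>C\<rceil>)" by (rule real_nat_ceiling_ge)
    finally show ?case by (simp only: of_nat_le_iff)
  qed
  define S where "S = nat \<lceil>C\<rceil>"
  note sS = sS[folded S_def]
  have model: "\<forall>\<^sub>F m in sequentially. random_attribute_set m (s m) (P m)"
    using sS eventually_gt_at_top[of S]
  proof eventually_elim
    case (elim m)
    then show ?case using assms(2,3)[of m] by unfold_locales auto
  qed
  have fin: "\<forall>\<^sub>F m in sequentially. finite (set_pmf (P m))"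
    using eventually_ge_at_top[of 1] by eventually_elim (use assms(3) finite_subset in blast)
  have "\<forall>\<^sub>F m in sequentially. \<beta> / 2 < real (m choose s m) / real (n m)"
    using ratio by (rule order_tendstoD) (use \<beta> in simp)
  moreover have "\<forall>\<^sub>F m in sequentially. real (m choose s m) / real (n m) < 2 * \<beta>"
    using ratio by (rule order_tendstoD) (use \<beta> in simp)
  \<comment> \<open>Since \<open>m choose s\<close> is at least \<open>m - s\<close>, large
    \<open>m\<close> gives \<open>6 * \<beta> \<le> m choose s < 2 * \<beta> * n\<close>, so
    \<open>n > 3\<close>.\<close>
  ultimately have n3: "\<forall>\<^sub>F m in sequentially. 3 \<le> n m"
    using sS model eventually_ge_at_top[of "S + nat \<lceil>6 * \<beta>\<rceil>"]
  proof eventually_elim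
    case (elim m)
    interpret random_attribute_set m "s m" "P m" by (rule elim(4))
    have "m \<le> (m choose s m) + s m" by (rule choose_le_lower_index[OF s_pos order_refl])
    then have "6 * \<beta> \<le> real (m choose s m)" using elim(3,5) by linarith
    \<comment> \<open>\<open>n = 0\<close> would make the quotient \<open>0\<close> by
      \<open>x / 0 = 0\<close>, against its positive lower bound.\<close>
    moreover have n0: "0 < n m" using elim(1) \<beta> by (cases "n m") auto
    ultimately have "6 * \<beta> < 2 * \<beta> * real (n m)" using elim(2) by (simp add: field_simps)
    then show ?case using \<beta> by simp
  qed
  \<comment> \<open>The factor taking \<open>Y\<close> to \<open>Zvar\<close>; as the power
    \<open>-1/2\<close> of a ratio tending to \<open>\<beta>\<close> it converges to
    \<open>1 / sqrt \<beta>\<close>.\<close>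
  define c where "c m = real (m choose s m) powr (-1/2) * real (n m) powr (1/2)" for m
  have X_eq: "?X m k = c m * ?Y m k" for m k
    by (simp add: Zvar_eq_subset_count c_def)
  have X_nonneg: "0 \<le> ?X m k" for m k
    by (simp add: Zvar_def)
  have "(\<lambda>m. (real (m choose s m) / real (n m)) powr (-1/2)) \<longlonglongrightarrow> \<beta> powr (-1/2)"
    using \<beta> by (intro tendsto_intros ratio) auto
  moreover have "(real (m choose s m) / real (n m)) powr (-1/2) = c m" for m
    by (simp add: c_def powr_divide powr_minus field_simps)
  moreover have "\<beta> powr (-1/2) = 1 / sqrt \<beta>"
    using \<beta> by (simp add: powr_minus_divide powr_half_sqrt)
  ultimately have c: "c \<longlonglongrightarrow> 1 / sqrt \<beta>" by simp
  \<comment> \<open>Half the limit of \<open>c\<close>, hence a positive lower bound for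
    \<open>c m\<close> eventually.\<close>
  define c0 where "c0 = 1 / (2 * sqrt \<beta>)"
  have c0: "0 < c0" using \<beta> by (simp add: c0_def)
  have "\<forall>\<^sub>F m in sequentially. c0 < c m"
    using c by (rule order_tendstoD) (use \<beta> in \<open>simp add: c0_def field_simps\<close>)
  then have c_ge: "\<forall>\<^sub>F m in sequentially. c0 \<le> c m" by eventually_elim simp
  have moment: "(\<lambda>m. ?E m (\<lambda>k. ?Y m k ^ q)) \<longlonglongrightarrow> t * sqrt \<beta> ^ q"
    if "(\<lambda>m. ?E m (\<lambda>k. ?X m k ^ q)) \<longlonglongrightarrow> t" for q t
  proof -
    have "(\<lambda>m. ?E m (\<lambda>k. ?X m k ^ q) / c m ^ q) \<longlonglongrightarrow> t / (1 / sqrt \<beta>) ^ q"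
      using \<beta> by (intro tendsto_intros c that) auto
    moreover have "\<forall>\<^sub>F m in sequentially. ?E m (\<lambda>k. ?X m k ^ q) / c m ^ q = ?E m (\<lambda>k. ?Y m k ^ q)"
      using c_ge by eventually_elim (use c0 in \<open>simp add: X_eq power_mult_distrib\<close>)
    ultimately have "(\<lambda>m. ?E m (\<lambda>k. ?Y m k ^ q)) \<longlonglongrightarrow> t / (1 / sqrt \<beta>) ^ q"
      by (rule Lim_transform_eventually)
    then show ?thesis by (simp add: power_divide)
  qed
  have Z_nonneg: "AE \<omega> in M. 0 \<le> Z \<omega>"
    by (rule weak_conv_nonneg_limit[OF M Z conv X_nonneg])
  have mean: "(\<lambda>m. ?E m (?Y m)) \<longlonglongrightarrow> (\<integral>\<omega>. Z \<omega> \<partial>M) * sqrt \<beta>"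
    using moment[of 1] assms(10) by simp
  \<comment> \<open>As \<open>Z\<close> is nonnegative, its mean is positive unless it vanishes
    almost everywhere; both cases of the theorem exclude the latter through the second
    moment.\<close>
  have mean_pos: "0 < (\<integral>\<omega>. Z \<omega> \<partial>M) * sqrt \<beta>" if "\<not> (AE \<omega> in M. Z \<omega> = 0)"
  proof -
    have "(\<integral>\<omega>. Z \<omega> \<partial>M) \<noteq> 0"
      using that integral_nonneg_eq_0_iff_AE[OF assms(9) Z_nonneg] by simp
    moreover have "0 \<le> (\<integral>\<omega>. Z \<omega> \<partial>M)"
      by (rule integral_nonneg_AE[OF Z_nonneg])
    ultimately show ?thesis using \<beta> by simp
  qed
  have intX: "\<forall>\<^sub>F m in sequentially. integrable (measure_pmf (P m)) (f m)" for f :: "nat \<Rightarrow> nat \<Rightarrow> real"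
    using fin by eventually_elim (rule integrable_measure_pmf_finite)
  have tail: "\<exists>K. \<forall>\<^sub>F m in sequentially. ?E m (\<lambda>k. high_count (s m) K k * ?Y m k ^ q) \<le> \<epsilon>"
    if q: "q = 1 \<or> q = 2" and int: "integrable M (\<lambda>\<omega>. \<bar>Z \<omega>\<bar> ^ q)"
      and lim: "(\<lambda>m. ?E m (\<lambda>k. ?X m k ^ q)) \<longlonglongrightarrow> (\<integral>\<omega>. \<bar>Z \<omega>\<bar> ^ q \<partial>M)" and \<epsilon>: "0 < \<epsilon>" for q \<epsilon>
  proof -
    \<comment> \<open>The absolute value makes the test function nonnegative on the whole line; it
      disappears afterwards because \<open>Zvar\<close> is nonnegative.\<close>
    have "\<exists>L\<ge>0. \<forall>\<^sub>F m in sequentially. ?E m (\<lambda>k. of_bool (L < \<bar>?X m k\<bar> ^ q) * \<bar>?X m k\<bar> ^ q) \<le> c0 ^ q * \<epsilon>"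
      using lim c0 \<epsilon> X_nonneg
      by (intro weak_conv_tail_expectation[OF M Z conv _ _ int intX]) (auto intro!: continuous_intros)
    then obtain L where L: "0 \<le> L"
      "\<forall>\<^sub>F m in sequentially. ?E m (\<lambda>k. of_bool (L < ?X m k ^ q) * ?X m k ^ q) \<le> c0 ^ q * \<epsilon>"
      using X_nonneg by auto
    obtain K :: nat where K: "(L + 1) / c0 \<le> real K" using real_arch_simple by blast
    have "\<forall>\<^sub>F m in sequentially. ?E m (\<lambda>k. high_count (s m) K k * ?Y m k ^ q) \<le> \<epsilon>"
      using L(2) fin c_ge
    proof eventually_elim
      case (elim m)
      show ?case
        using elim c0 K L(1) q unfolding X_eq
        by (intro tail_rescale[where c = "c m" and L = L]) (auto simp: field_simps)
    qed
    then show ?thesis by blast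
  qed
  have part_a: "(\<lambda>m. clustering_coeff (n m) (s m) m (P m)) \<longlonglongrightarrow>
      1 / sqrt \<beta> * ((\<integral>\<omega>. Z \<omega> \<partial>M) / (\<integral>\<omega>. (Z \<omega>)\<^sup>2 \<partial>M))"
    if int2: "integrable M (\<lambda>\<omega>. (Z \<omega>)\<^sup>2)" and pos2: "0 < (\<integral>\<omega>. (Z \<omega>)\<^sup>2 \<partial>M)"
      and lim2: "(\<lambda>m. ?E m (\<lambda>x. (?X m x)\<^sup>2)) \<longlonglongrightarrow> (\<integral>\<omega>. (Z \<omega>)\<^sup>2 \<partial>M)"
  proof -
    have "\<not> (AE \<omega> in M. Z \<omega> = 0)"
    proof
      assume "AE \<omega> in M. Z \<omega> = 0"
      then have "(\<integral>\<omega>. (Z \<omega>)\<^sup>2 \<partial>M) = 0" by (intro integral_eq_zero_AE) auto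
      then show False using pos2 by simp
    qed
    then have "(\<lambda>m. clustering_coeff (n m) (s m) m (P m)) \<longlonglongrightarrow>
      ((\<integral>\<omega>. Z \<omega> \<partial>M) * sqrt \<beta>) / ((\<integral>\<omega>. (Z \<omega>)\<^sup>2 \<partial>M) * sqrt \<beta> ^ 2)"
      using \<beta> pos2 tail[of 2] int2 lim2
      by (intro clustering_coeff_tendsto[OF model n3 sS mean mean_pos moment[OF lim2]]) auto
    \<comment> \<open>One factor \<open>sqrt \<beta>\<close> from the first moment against two from
      the second leaves \<open>1 / sqrt \<beta>\<close>.\<close>
    moreover have cancel: "(a * r) / (b * r ^ 2) = 1 / r * (a / b)" if "r \<noteq> 0" for a b r :: real
      using that by (simp add: power2_eq_square)
    have "((\<integral>\<omega>. Z \<omega> \<partial>M) * sqrt \<beta>) / ((\<integral>\<omega>. (Z \<omega>)\<^sup>2 \<partial>M) * sqrt \<beta> ^ 2)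
        = 1 / sqrt \<beta> * ((\<integral>\<omega>. Z \<omega> \<partial>M) / (\<integral>\<omega>. (Z \<omega>)\<^sup>2 \<partial>M))"
      by (rule cancel) (use \<beta> in simp)
    ultimately show ?thesis by (simp only:)
  qed
  have part_b: "(\<lambda>m. clustering_coeff (n m) (s m) m (P m)) \<longlonglongrightarrow> 0"
    if inf: "(\<integral>\<^sup>+\<omega>. ennreal ((Z \<omega>)\<^sup>2) \<partial>M) = \<infinity>"
  proof (rule clustering_coeff_tendsto_0[OF model n3 sS mean mean_pos])
    show "\<not> (AE \<omega> in M. Z \<omega> = 0)"
    proof
      assume "AE \<omega> in M. Z \<omega> = 0"
      then have "AE \<omega> in M. ennreal ((Z \<omega>)\<^sup>2) = 0" by eventually_elim simp
      then have "(\<integral>\<^sup>+\<omega>. ennreal ((Z \<omega>)\<^sup>2) \<partial>M) = 0"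
        by (subst nn_integral_0_iff_AE) auto
      then show False using inf by simp
    qed
    \<comment> \<open>The infinite limit forces these moments to diverge, and dividing by the square
      of \<open>c m\<close>, which has a positive limit, preserves this.\<close>
    have "filterlim (\<lambda>m. ?E m (\<lambda>k. (?X m k)\<^sup>2)) at_top sequentially"
      by (rule weak_conv_expectation_at_top[OF M Z conv _ _ inf intX]) (auto intro!: continuous_intros)
    moreover have "(\<lambda>m. 1 / (c m)\<^sup>2) \<longlonglongrightarrow> 1 / (1 / sqrt \<beta>)\<^sup>2"
      using \<beta> by (intro tendsto_intros c) auto
    ultimately have "filterlim (\<lambda>m. 1 / (c m)\<^sup>2 * ?E m (\<lambda>k. (?X m k)\<^sup>2)) at_top sequentially"
      by (rule filterlim_tendsto_pos_mult_at_top[rotated 2]) (use \<beta> in simp)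
    moreover have "\<forall>\<^sub>F m in sequentially. 1 / (c m)\<^sup>2 * ?E m (\<lambda>k. (?X m k)\<^sup>2) = ?E m (\<lambda>k. (?Y m k)\<^sup>2)"
      using c_ge by eventually_elim (use c0 in \<open>simp add: X_eq power_mult_distrib\<close>)
    ultimately show "filterlim (\<lambda>m. ?E m (\<lambda>k. (?Y m k)\<^sup>2)) at_top sequentially"
      by (rule filterlim_cong[OF refl refl, THEN iffD1, rotated])
    have "(\<integral>\<omega>. \<bar>Z \<omega>\<bar> \<partial>M) = (\<integral>\<omega>. Z \<omega> \<partial>M)"
      using Z_nonneg by (intro integral_cong_AE) auto
    then show "\<exists>K. \<forall>\<^sub>F m in sequentially. ?E m (\<lambda>k. high_count (s m) K k * ?Y m k) \<le> \<epsilon>" if "0 < \<epsilon>" for \<epsilon>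
      using tail[of 1 \<epsilon>] that assms(9,10) by simp
  qed
  show ?thesis
    using part_a part_b
    by (auto intro!: smalloI_tendsto simp: LIM_zero_iff)
qed

end
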